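(* Let $u$ be a prime number and $a\ge 2$ an integer, with $(u,a)\neq(2,2)$. Let $n=u^{a-1}$, $N=2^{n}-1$, $\alpha$ a primitive element of $\mathbb{F}_{2^n}$, and let $C$ be the dual of the binary double-error-correcting BCH code of length $N$, $$C=\left\{\left(\mathrm{Tr}_{\mathbb{F}_{2^n}/\mathbb{F}_2}(\lambda\alpha^k+\beta\alpha^{3k})\right)_{0\le k\le N-1}:\lambda,\beta\in\mathbb{F}_{2^n}\right\}.$$ For $1\le i\le a$ let $L_i=\dfrac{2^{u^{a-1}}-1}{2^{u^{i-1}}-1}$, and for $0\le j\le a-1$ let $$A_j=N(u^{a-j-1},2^{u^j})-N(u^{a-j-2},2^{u^{j+1}}),$$ where for $j=a-1$ the second term is taken to be $0$ (so $A_{a-1}=1$). (i) If $u$ is odd, then $C$ has $3$ cyclic subcodes (including itself), $$3A_{a-2}+A_{a-2}N(u,2^{u^{a-2}})$$ quasi-cyclic subcodes of index $L_{a-1}$, and $$2A_{j-1}+A_{j-1}\left(N(u^{a-j},2^{u^{j-1}})+N(u^{a-j-1},2^{u^j})\right)$$ quasi-cyclic subcodes of index $L_j$ for any $2\le j\le a-2$. (ii) If $u=2$, then $C$ has $3$ cyclic subcodes (including itself) for any $a$. For $a\ge 4$, there are $$3A_{a-2}+A_{a-2}N(u,2^{u^{a-2}})$$ quasi-cyclic subcodes of index $L_{a-1}$, $$2A_{j-1}+A_{j-1}\left(N(u^{a-j},2^{u^{j-1}})+N(u^{a-j-1},2^{u^j})\right)$$ quasi-cyclic subcodes of index $L_j$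 for $3\le j\le a-2$, and $$2A_1+A_0+A_1N(u^{a-1},2)+(A_0+A_1)N(u^{a-3},2^{u^2})$$ quasi-cyclic subcodes of index $L_2$. If $a=3$, there are $$3A_1+2A_0+A_1N(u^2,2)$$ quasi-cyclic subcodes of index $L_2$.
   Context: A linear code $D\subseteq\mathbb{F}_2^N$ is quasi-cyclic of index $\ell$ if it is invariant under cyclic shift of codewords by $\ell$ positions and $\ell$ is the smallest positive integer with this property; index $1$ means cyclic. The zero code is not counted among the subcodes. For a prime power $Q$ and $m\ge 1$, $N(m,Q)$ denotes the number of nonzero $\mathbb{F}_Q$-subspaces of an $m$-dimensional $\mathbb{F}_Q$-vector space: $$N(m,Q)=\sum_{k=1}^{m}\frac{(Q^m-1)(Q^m-Q)\cdots(Q^m-Q^{k-1})}{(Q^k-1)(Q^k-Q)\cdots(Q^k-Q^{k-1})}.$$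
   Formalization: In (i), the count of quasi-cyclic subcodes of index L_{a-1} is stated only for a ≥ 3; for a = 2 the index is L_1 = N and the printed formula is false (u = 3, a = 2: formula gives 252, the true count is 2821). *)

theory Defs
  imports "Jordan_Normal_Form.VS_Connect" "HOL-Library.Z2" "HOL-Library.Cardinality" "HOL-Number_Theory.Residues"
begin

definition linear_code :: "nat \<Rightarrow> bit vec set \<Rightarrow> bool" where
  "linear_code N D \<longleftrightarrow> VectorSpace.subspace class_ring D (module_vec TYPE(bit) N)"

(* Cyclic shift by l positions to the left.  Shifts have finite order, so invariance of a code does
   not depend on the direction. *)
definition cyclic_shift :: "nat \<Rightarrow> 'a vec \<Rightarrow> 'a vec" where
  "cyclic_shift l v = vec (dim_vec v) (\<lambda>i. v $ ((i + l) mod dim_vec v))"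

definition shift_invariant :: "nat \<Rightarrow> 'a vec set \<Rightarrow> bool" where
  "shift_invariant l D \<longleftrightarrow> (\<forall>v\<in>D. cyclic_shift l v \<in> D)"

definition quasi_cyclic :: "nat \<Rightarrow> nat \<Rightarrow> bit vec set \<Rightarrow> bool" where
  "quasi_cyclic N l D \<longleftrightarrow> linear_code N D \<and> 0 < l \<and> shift_invariant l D \<and>
     (\<forall>m. 0 < m \<and> m < l \<longrightarrow> \<not> shift_invariant m D)"

definition qc_subcodes :: "nat \<Rightarrow> nat \<Rightarrow> bit vec set \<Rightarrow> bit vec set set" where
  "qc_subcodes N l C = {D. D \<subseteq> C \<and> D \<noteq> {0\<^sub>v N} \<and> quasi_cyclic N l D}"

definition cyclic_subcodes :: "nat \<Rightarrow> bit vec set \<Rightarrow> bit vec set set" where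
  "cyclic_subcodes N C = qc_subcodes N 1 C"

definition primitive_element :: "'f::field \<Rightarrow> bool" where
  "primitive_element \<alpha> \<longleftrightarrow> \<alpha> \<noteq> 0 \<and> (\<forall>x. x \<noteq> 0 \<longrightarrow> (\<exists>k::nat. x = \<alpha> ^ k))"

definition trace_sum :: "nat \<Rightarrow> 'f::field \<Rightarrow> 'f" where
  "trace_sum n x = (\<Sum>i<n. x ^ (2 ^ i))"

(* The trace from a field with 2^n elements to its prime field {0,1}, the latter identified with
   the type bit; see of_bool_trace below. *)
definition trace :: "nat \<Rightarrow> 'f::field \<Rightarrow> bit" where
  "trace n x = of_bool (trace_sum n x = 1)"

lemma of_bool_trace:
  fixes x :: "'f :: finite_field"
  assumes card: "CARD('f) = 2 ^ n"
  shows "of_bool (trace n x = 1) = trace_sum n x"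
proof -
  have p: "prime CHAR('f)" by (intro prime_CHAR_semidom finite_imp_CHAR_pos finite)
  have "CHAR('f) dvd 2 ^ n" unfolding card[symmetric] by (rule CHAR_dvd_CARD)
  then have "CHAR('f) dvd 2" by (meson p prime_dvd_power)
  with p have char: "CHAR('f) = 2" by (simp add: primes_dvd_imp_eq)
  have x: "x ^ (2 ^ n) = x" using finite_field_power_card_eq_same[of x] card by simp
  have "trace_sum n x ^ 2 = (\<Sum>i<n. (x ^ (2 ^ i)) ^ 2)"
    unfolding trace_sum_def by (rule freshmans_dream_sum) (use char p in simp_all)
  also have "\<dots> = (\<Sum>i<n. x ^ (2 ^ Suc i))"
    by (simp only: power_mult[symmetric] power_Suc2)
  finally have "trace_sum n x ^ 2 = (\<Sum>i<n. x ^ (2 ^ Suc i))" .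
  moreover have "x ^ (2 ^ 0) + (\<Sum>i<n. x ^ (2 ^ Suc i)) = (\<Sum>i<n. x ^ (2 ^ i)) + x ^ (2 ^ n)"
    by (rule trans[OF sum.lessThan_Suc_shift[of "\<lambda>i. x ^ (2 ^ i)" n, symmetric] sum.lessThan_Suc])
  ultimately have "trace_sum n x ^ 2 = trace_sum n x" by (simp only: x trace_sum_def power_0 power_one_right add.commute[of x] add_right_cancel)
  then have "trace_sum n x = 0 \<or> trace_sum n x = 1" by (simp add: power2_eq_square)
  then show ?thesis by (auto simp: trace_def)
qed

definition dual_bch :: "nat \<Rightarrow> 'f::field \<Rightarrow> bit vec set" where
  "dual_bch n \<alpha> =
     {vec (2 ^ n - 1) (\<lambda>k. trace n (x * \<alpha> ^ k + y * \<alpha> ^ (3 * k))) | x y. True}"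

definition num_subspaces :: "nat \<Rightarrow> nat \<Rightarrow> real" where
  "num_subspaces m Q =
     (\<Sum>k = 1..m. (\<Prod>i<k. real Q ^ m - real Q ^ i) / (\<Prod>i<k. real Q ^ k - real Q ^ i))"

(* The division is exact, since u^(i-1) divides u^(a-1).  The index for i = 1 is the length N itself,
   for which quasi-cyclicity is no condition; for odd u the count of subcodes of index number a - 1
   is therefore stated for a >= 3 only (it fails for u = 3, a = 2, where the formula gives 252 but
   2821 of the 2824 nonzero subcodes have index 7). *)
definition qc_index :: "nat \<Rightarrow> nat \<Rightarrow> nat \<Rightarrow> nat" where
  "qc_index u a i = (2 ^ (u ^ (a - 1)) - 1) div (2 ^ (u ^ (i - 1)) - 1)"

definition A_coeff :: "nat \<Rightarrow> nat \<Rightarrow> nat \<Rightarrow> real" where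
  "A_coeff u a j = num_subspaces (u ^ (a - j - 1)) (2 ^ (u ^ j)) -
     (if j = a - 1 then 0 else num_subspaces (u ^ (a - j - 2)) (2 ^ (u ^ (j + 1))))"

end

theory Submission
  imports Defs "HOL-Library.Product_Plus"
begin

text \<open>
  The codeword of \<open>(\<lambda>, \<beta>)\<close> depends additively and injectively on the pair, and shifting it by
  \<open>l\<close> positions multiplies the pair by \<open>(\<alpha>\<^sup>l, \<alpha>\<^sup>3\<^sup>l)\<close>. For \<open>l = L\<^sub>j\<close> the element \<open>\<alpha>\<^sup>l\<close> generates the
  multiplicative group of the subfield \<open>K\<close> with \<open>2 ^ u ^ (j - 1)\<close> elements. If \<open>j \<ge> 2\<close>, cubing is not
  additive on \<open>K\<close>, so the invariant subgroups are exactly the products \<open>V \<times> V'\<close> of a \<open>K\<close>-subspace and a subspace over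
  the field generated by the cubes of \<open>K\<close>; the latter is \<open>K\<close>, except that it is the prime field when
  \<open>K\<close> has four elements. The subfields form a chain, so such a product is invariant
  under a smaller shift iff both factors are subspaces over the next subfield. The number of
  subcodes of index \<open>L\<^sub>j\<close> is therefore a difference of two products of numbers of subspaces.
\<close>

subsection \<open>Counting subspaces\<close>

text \<open>The ambient space is the field itself and the scalars are a subset of it, so all
  subfields of the chain act on one type.\<close>

definition subspaces :: "'a::field set \<Rightarrow> 'a set set" where
  "subspaces K = {V. 0 \<in> V \<and> (\<forall>x\<in>V. \<forall>y\<in>V. x + y \<in> V) \<and> (\<forall>c\<in>K. \<forall>x\<in>V. c * x \<in> V)}"

definition subfield_set :: "'a::field set \<Rightarrow> bool" where
  "subfield_set K \<longleftrightarrow> 0 \<in> K \<and> 1 \<in> K \<and> (\<forall>x\<in>K. \<forall>y\<in>K. x - y \<in> K \<and> x * y \<in> K) \<and>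
     (\<forall>x\<in>K. inverse x \<in> K)"

fun list_span :: "'a::field set \<Rightarrow> 'a list \<Rightarrow> 'a set" where
  "list_span K [] = {0}"
| "list_span K (x # xs) = (\<lambda>(c, w). c * x + w) ` (K \<times> list_span K xs)"

text \<open>In this form, the independent extensions of a list by one entry are counted by the
  complement of its span.\<close>

fun list_indep :: "'a::field set \<Rightarrow> 'a list \<Rightarrow> bool" where
  "list_indep K [] \<longleftrightarrow> True"
| "list_indep K (x # xs) \<longleftrightarrow> list_indep K xs \<and> x \<notin> list_span K xs"

lemma subspacesD:
  assumes "V \<in> subspaces K"
  shows "0 \<in> V" "\<And>x y. x \<in> V \<Longrightarrow> y \<in> V \<Longrightarrow> x + y \<in> V" "\<And>c x. c \<in> K \<Longrightarrow> x \<in> V \<Longrightarrow> c * x \<in> V"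
  using assms by (auto simp: subspaces_def)

lemma subfield_setD:
  assumes "subfield_set K"
  shows "0 \<in> K" "1 \<in> K" "\<And>x y. x \<in> K \<Longrightarrow> y \<in> K \<Longrightarrow> x - y \<in> K"
    "\<And>x y. x \<in> K \<Longrightarrow> y \<in> K \<Longrightarrow> x + y \<in> K" "\<And>x y. x \<in> K \<Longrightarrow> y \<in> K \<Longrightarrow> x * y \<in> K"
    "\<And>x. x \<in> K \<Longrightarrow> inverse x \<in> K"
proof -
  show *: "0 \<in> K" "1 \<in> K" "\<And>x y. x \<in> K \<Longrightarrow> y \<in> K \<Longrightarrow> x - y \<in> K"
     "\<And>x y. x \<in> K \<Longrightarrow> y \<in> K \<Longrightarrow> x * y \<in> K" "\<And>x. x \<in> K \<Longrightarrow> inverse x \<in> K"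
    using assms by (auto simp: subfield_set_def)
  show "x + y \<in> K" if "x \<in> K" "y \<in> K" for x y
    using *(3)[OF that(1) *(3)[OF *(1) that(2)]] by simp
qed

context
  fixes K :: "'a::field set"
  assumes K: "subfield_set K"
begin

lemma subspaces_diff:
  assumes "V \<in> subspaces K" "x \<in> V" "y \<in> V"
  shows "x - y \<in> V"
proof -
  have "- 1 \<in> K" using subfield_setD(3)[OF K subfield_setD(1,2)[OF K]] by simp
  then have "- 1 * y \<in> V" using subspacesD(3)[OF assms(1)] assms(3) by blast
  then show ?thesis using subspacesD(2)[OF assms(1,2)] by fastforce
qed

lemma list_span_subspace: "list_span K xs \<in> subspaces K"
proof (induction xs)
  case Nil
  show ?case by (simp add: subspaces_def)
next
  case (Cons x xs)
  note IH = subspacesD[OF Cons]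
  have "0 \<in> list_span K (x # xs)"
    using IH(1) subfield_setD(1)[OF K] by (force simp: image_iff)
  moreover have "(a * x + v) + (b * x + w) \<in> list_span K (x # xs)"
    if "a \<in> K" "b \<in> K" "v \<in> list_span K xs" "w \<in> list_span K xs" for a b v w
    using that IH(2) subfield_setD(4)[OF K]
    by (auto simp: algebra_simps intro!: rev_image_eqI[of "(a + b, v + w)"])
  moreover have "c * (a * x + v) \<in> list_span K (x # xs)"
    if "c \<in> K" "a \<in> K" "v \<in> list_span K xs" for c a v
    using that IH(3) subfield_setD(5)[OF K]
    by (auto simp: algebra_simps intro!: rev_image_eqI[of "(c * a, c * v)"])
  ultimately show ?case unfolding subspaces_def by fastforce
qed

lemma list_span_least: "V \<in> subspaces K \<Longrightarrow> set xs \<subseteq> V \<Longrightarrow> list_span K xs \<subseteq> V"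
proof (induction xs)
  case (Cons x xs)
  then show ?case using subspacesD(2)[OF Cons.prems(1) subspacesD(3)[OF Cons.prems(1)]] by auto
qed (simp add: subspacesD(1))

lemma set_subset_list_span: "set xs \<subseteq> list_span K xs"
proof (induction xs)
  case (Cons x xs)
  have "(1, 0) \<in> K \<times> list_span K xs"
    using subspacesD(1)[OF list_span_subspace] subfield_setD(2)[OF K] by auto
  then have "x \<in> list_span K (x # xs)" by (force simp: image_iff)
  moreover have "list_span K xs \<subseteq> list_span K (x # xs)"
    using subfield_setD(1)[OF K] by (force simp: image_iff)
  ultimately show ?case using Cons by auto
qed simp

text \<open>If two different coefficients of \<open>x\<close> led to the same vector, solving for
  \<open>x\<close> would put it into the span of \<open>xs\<close>. So each new entry multiplies the
  size by \<open>card K\<close>.\<close>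

lemma card_list_span: "list_indep K xs \<Longrightarrow> card (list_span K xs) = card K ^ length xs"
proof (induction xs)
  case (Cons x xs)
  have "inj_on (\<lambda>(c, w). c * x + w) (K \<times> list_span K xs)"
  proof (intro inj_onI, clarify)
    fix a v b w
    assume *: "a \<in> K" "b \<in> K" "v \<in> list_span K xs" "w \<in> list_span K xs" "a * x + v = b * x + w"
    then have eq: "(a - b) * x = w - v" by (simp add: algebra_simps)
    have "a = b"
    proof (rule ccontr)
      assume "a \<noteq> b"
      then have "x = inverse (a - b) * (w - v)" by (simp flip: eq add: field_simps)
      moreover have "inverse (a - b) * (w - v) \<in> list_span K xs"
        using * by (intro subspacesD(3)[OF list_span_subspace] subspaces_diff[OF list_span_subspace]
            subfield_setD(6)[OF K] subfield_setD(3)[OF K])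
      ultimately show False using Cons.prems by simp
    qed
    with eq show "a = b \<and> v = w" by simp
  qed
  then show ?case using Cons by (simp add: card_image card_cartesian_product)
qed simp

end

lemma subfield_set_card_ge: "subfield_set K \<Longrightarrow> finite K \<Longrightarrow> 2 \<le> card K"
  using card_mono[of K "{0,1}"] by (simp add: subfield_set_def)

context
  fixes K :: "'a::{field,finite} set"
  assumes K: "subfield_set K"
begin

text \<open>An independent list of length \<open>k\<close> can be extended by any vector of
  \<open>V\<close> outside its span, which has \<open>card K ^ k\<close> elements. Beyond the
  dimension of \<open>V\<close> the product contains a factor 0.\<close>

lemma card_indep_lists:
  assumes V: "V \<in> subspaces K"
  shows "card {xs. set xs \<subseteq> V \<and> list_indep K xs \<and> length xs = k} = (\<Prod>i<k. card V - card K ^ i)"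
proof (induction k)
  case 0
  have "{xs. set xs \<subseteq> V \<and> list_indep K xs \<and> length xs = 0} = {[]}" by auto
  then show ?case by simp
next
  case (Suc k)
  let ?S = "{xs. set xs \<subseteq> V \<and> list_indep K xs \<and> length xs = k}"
  have fin: "finite ?S" by (rule finite_subset[OF _ finite_lists_length_eq[of V k]]) auto
  have "{xs. set xs \<subseteq> V \<and> list_indep K xs \<and> length xs = Suc k} =
      (\<lambda>(xs, x). x # xs) ` (SIGMA xs:?S. V - list_span K xs)"
    by (auto simp: length_Suc_conv image_iff)
  also have "card \<dots> = card (SIGMA xs:?S. V - list_span K xs)"
    by (rule card_image) (auto simp: inj_on_def)
  also have "\<dots> = (\<Sum>xs\<in>?S. card (V - list_span K xs))"
    using fin by simp
  also have "\<dots> = (\<Sum>xs\<in>?S. card V - card K ^ k)"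
    by (rule sum.cong)
      (auto simp: card_Diff_subset list_span_least[OF K V] card_list_span[OF K])
  also have "\<dots> = (\<Prod>i<Suc k. card V - card K ^ i)"
    by (simp add: Suc)
  finally show ?case .
qed

text \<open>The span of an independent list has more elements than the list has entries, so lengths
  inside \<open>V\<close> are bounded, and a longest independent list spans
  \<open>V\<close>.\<close>

lemma subspace_has_basis:
  assumes V: "V \<in> subspaces K"
  obtains xs where "list_indep K xs" "list_span K xs = V"
proof -
  let ?P = "\<lambda>xs. set xs \<subseteq> V \<and> list_indep K xs"
  have bound: "length xs < Suc (card V)" if "?P xs" for xs
  proof -
    have "length xs < card K ^ length xs"
      using subfield_set_card_ge[OF K] by (intro power_gt_expt) auto
    also have "\<dots> \<le> card V"
      using card_mono[OF _ list_span_least[OF K V]] card_list_span[OF K] that by fastforce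
    finally show ?thesis by simp
  qed
  obtain xs where xs: "?P xs" and max: "\<And>ys. ?P ys \<Longrightarrow> length ys \<le> length xs"
    using ex_has_greatest_nat[of ?P "[]" length "Suc (card V)"] bound by (auto simp: less_imp_le)
  have "V \<subseteq> list_span K xs"
  proof
    fix x assume "x \<in> V"
    then show "x \<in> list_span K xs" using max[of "x # xs"] xs by (auto simp del: list_span.simps)
  qed
  then show ?thesis using that[of xs] list_span_least[OF K V] xs by auto
qed

text \<open>Double counting: the independent lists of length \<open>k\<close> in the whole field are
  grouped by their span, and the group of \<open>V\<close> consists of the independent lists of that
  length inside \<open>V\<close>.\<close>

lemma card_subspaces_of_card:
  "card {V \<in> subspaces K. card V = card K ^ k} * (\<Prod>i<k. card K ^ k - card K ^ i) =
     (\<Prod>i<k. CARD('a) - card K ^ i)"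
proof -
  let ?S = "{xs. set xs \<subseteq> (UNIV :: 'a set) \<and> list_indep K xs \<and> length xs = k}"
  let ?T = "{V \<in> subspaces K. card V = card K ^ k}"
  have U: "UNIV \<in> subspaces K" by (simp add: subspaces_def)
  have fin: "finite ?S"
    by (rule finite_subset[OF _ finite_lists_length_eq[of UNIV k]]) auto
  have fib: "{xs \<in> ?S. list_span K xs = V} = {xs. set xs \<subseteq> V \<and> list_indep K xs \<and> length xs = k}"
    if "V \<in> ?T" for V
  proof -
    have "list_span K xs = V" if "set xs \<subseteq> V" "list_indep K xs" "length xs = k" for xs
      using list_span_least[OF K, of V xs] card_list_span[OF K, of xs] that \<open>V \<in> ?T\<close>
      by (intro card_subset_eq) auto
    then show ?thesis using set_subset_list_span[OF K] by blast
  qed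
  have "(\<Prod>i<k. CARD('a) - card K ^ i) = card ?S"
    by (rule card_indep_lists[OF U, symmetric])
  also have "\<dots> = (\<Sum>xs\<in>?S. 1)" by simp
  also have "\<dots> = (\<Sum>V\<in>?T. \<Sum>xs\<in>{xs \<in> ?S. list_span K xs = V}. 1)"
    by (rule sum.group[symmetric, OF fin])
      (auto simp: list_span_subspace[OF K] card_list_span[OF K])
  also have "\<dots> = (\<Sum>V\<in>?T. \<Prod>i<k. card V - card K ^ i)"
    using fib card_indep_lists by (intro sum.cong) auto
  also have "\<dots> = card ?T * (\<Prod>i<k. card K ^ k - card K ^ i)" by simp
  finally show ?thesis by simp
qed

text \<open>Summation over the dimension. The extra 1 is the zero subspace, which
  \<open>num_subspaces\<close> leaves out.\<close>

lemma card_subspaces: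
  assumes "CARD('a) = card K ^ m"
  shows "real (card (subspaces K)) = 1 + num_subspaces m (card K)"
proof -
  let ?Q = "card K" and ?T = "\<lambda>k. {V \<in> subspaces K. card V = card K ^ k}"
  have Q: "2 \<le> ?Q" by (rule subfield_set_card_ge[OF K]) simp
  have T: "real (card (?T k)) = (\<Prod>i<k. real ?Q ^ m - real ?Q ^ i) / (\<Prod>i<k. real ?Q ^ k - real ?Q ^ i)"
    if "k \<le> m" for k
  proof -
    \<comment> \<open>Every exponent \<open>i\<close> is below \<open>l\<close>, so the natural
      subtraction does not truncate.\<close>
    have r: "real (\<Prod>i<k. ?Q ^ l - ?Q ^ i) = (\<Prod>i<k. real ?Q ^ l - real ?Q ^ i)" if "k \<le> l" for l
      using that Q by (auto simp: of_nat_diff power_increasing intro!: prod.cong)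
    have "real (card (?T k)) * (\<Prod>i<k. real ?Q ^ k - real ?Q ^ i) = (\<Prod>i<k. real ?Q ^ m - real ?Q ^ i)"
      using arg_cong[OF card_subspaces_of_card[of k], of real] that
      by (simp add: r[symmetric] assms)
    moreover have "(\<Prod>i<k. real ?Q ^ k - real ?Q ^ i) \<noteq> 0"
      using Q by (auto simp: power_inject_exp)
    ultimately show ?thesis by (simp add: field_simps)
  qed
  have "subspaces K = (\<Union>k\<in>{0..m}. ?T k)"
  proof (intro equalityI subsetI)
    fix V assume V: "V \<in> subspaces K"
    obtain xs where xs: "list_indep K xs" "list_span K xs = V" by (rule subspace_has_basis[OF V])
    then have cV: "card V = ?Q ^ length xs" using card_list_span[OF K] by blast
    then have "?Q ^ length xs \<le> ?Q ^ m" using card_mono[of UNIV V] assms by simp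
    then have "length xs \<le> m" using Q by (simp add: power_increasing_iff)
    with cV V show "V \<in> (\<Union>k\<in>{0..m}. ?T k)" by auto
  qed auto
  then have "card (subspaces K) = card (\<Union>k\<in>{0..m}. ?T k)" by simp
  also have "\<dots> = (\<Sum>k\<in>{0..m}. card (?T k))"
    using Q by (intro card_UN_disjoint) (auto simp: power_inject_exp)
  finally have "real (card (subspaces K)) = (\<Sum>k\<in>{0..m}. real (card (?T k)))" by simp
  also have "\<dots> = real (card (?T 0)) + (\<Sum>k=1..m. real (card (?T k)))"
    by (simp add: sum.atLeast_Suc_atMost)
  also have "(\<Sum>k=1..m. real (card (?T k))) = num_subspaces m ?Q"
    unfolding num_subspaces_def by (intro sum.cong) (auto simp: T)
  also have "real (card (?T 0)) = 1" using T[of 0] by simp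
  finally show ?thesis .
qed

end

lemma num_subspaces_1: "1 < Q \<Longrightarrow> num_subspaces 1 Q = 1"
  by (simp add: num_subspaces_def)

subsection \<open>Subfields of a finite field of characteristic two\<close>

text \<open>The fixed points of the \<open>d\<close>-th iterate of the Frobenius map of
  characteristic two. If \<open>d\<close> divides \<open>n\<close>, they form the subfield with
  \<open>2 ^ d\<close> elements of the field with \<open>2 ^ n\<close> elements.\<close>

definition frob_fixed :: "nat \<Rightarrow> 'a::field set" where
  "frob_fixed d = {y. y ^ 2 ^ d = y}"

lemma frob_fixed_mono:
  assumes "d dvd e"
  shows "frob_fixed d \<subseteq> (frob_fixed e :: 'a::field set)"
proof
  fix y :: 'a assume y: "y \<in> frob_fixed d"
  have "y ^ 2 ^ (d * k) = y" for k
  proof (induction k)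
    case (Suc k)
    have "y ^ 2 ^ (d * Suc k) = (y ^ 2 ^ d) ^ 2 ^ (d * k)" by (simp add: power_add power_mult)
    then show ?case using y Suc by (simp add: frob_fixed_def)
  qed simp
  then show "y \<in> frob_fixed e" using assms by (auto simp: frob_fixed_def elim!: dvdE)
qed

lemma geometric_sum_nat: "(q - 1) * (\<Sum>i<k. q ^ i) = q ^ k - 1" if "1 \<le> q" for q :: nat
proof -
  have "(q - 1) * (\<Sum>i<k. q ^ i) + 1 = q ^ k"
  proof (induction k)
    case (Suc k)
    have "(q - 1) * q ^ k + q ^ k = q * q ^ k" using that by (cases q) auto
    then show ?case using Suc by (simp add: distrib_left)
  qed simp
  then show ?thesis by simp
qed

text \<open>Multiplication by a nonzero \<open>y\<close> permutes the nonzero elements of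
  \<open>K\<close>; comparing their products gives \<open>y ^ (card K - 1) = 1\<close>.\<close>

lemma power_card_subfield:
  fixes y :: "'a::{field,finite}"
  assumes K: "subfield_set K" and y: "y \<in> K"
  shows "y ^ card K = y"
proof (cases "y = 0")
  case True
  then show ?thesis using subfield_set_card_ge[OF K finite] by simp
next
  case False
  have "\<Prod>(K - {0}) = (\<Prod>z\<in>K - {0}. y * z)"
    using False y subfield_setD(5,6)[OF K]
    by (intro prod.reindex_bij_witness[of _ "\<lambda>z. y * z" "\<lambda>z. inverse y * z"]) auto
  also have "\<dots> = y ^ (card K - 1) * \<Prod>(K - {0})"
    using subfield_setD(1)[OF K] by (simp add: prod.distrib card_Diff_singleton)
  finally have "y ^ (card K - 1) = 1" by simp
  moreover have "0 < card K" using subfield_set_card_ge[OF K finite] by linarith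
  ultimately show ?thesis using power_minus_mult[of "card K" y] by simp
qed

text \<open>The polynomial X^q - X with q = \<open>card K\<close> has at most q roots, and
  \<open>K\<close> already supplies that many. Hence a subfield is determined by its size.\<close>

lemma subfield_eq_power_fixed:
  fixes K :: "'a::{field,finite} set"
  assumes K: "subfield_set K"
  shows "K = {y. y ^ card K = y}"
proof (rule card_subset_eq)
  let ?p = "Polynomial.monom 1 (card K) - Polynomial.monom 1 1 :: 'a poly"
  have c: "2 \<le> card K" by (rule subfield_set_card_ge[OF K]) simp
  then have "Polynomial.coeff ?p (card K) = 1" by simp
  then have nz: "?p \<noteq> 0" by (metis coeff_0 zero_neq_one)
  have "Polynomial.degree ?p \<le> card K" using c by (intro degree_diff_le) (auto simp: degree_monom_eq)
  then have "card {y. poly ?p y = 0} \<le> card K" using card_poly_roots_bound[OF nz] by linarith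
  then have le: "card {y :: 'a. y ^ card K = y} \<le> card K" by (simp add: poly_monom)
  show sub: "K \<subseteq> {y. y ^ card K = y}" using power_card_subfield[OF K] by auto
  show "card K = card {y :: 'a. y ^ card K = y}" using le card_mono[OF _ sub] by simp
qed simp

section \<open>The field with \<open>2 ^ n\<close> elements and the powers of its primitive
  element\<close>

locale binary_field =
  fixes n :: nat and \<alpha> :: "'a::finite_field"
  assumes card_field: "CARD('a) = 2 ^ n" and primitive: "primitive_element \<alpha>"
begin

lemma n_pos: "0 < n"
proof (rule ccontr)
  assume "\<not> 0 < n"
  then have "CARD('a) = 1" using card_field by simp
  moreover have "card {0, 1 :: 'a} \<le> CARD('a)" by (rule card_mono) auto
  ultimately show False by simp
qed

lemma char_2: "CHAR('a) = 2"
proof -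
  have p: "prime CHAR('a)" by (intro prime_CHAR_semidom finite_imp_CHAR_pos finite)
  have "CHAR('a) dvd 2 ^ n" unfolding card_field[symmetric] by (rule CHAR_dvd_CARD)
  then show ?thesis using p by (meson prime_dvd_power primes_dvd_imp_eq two_is_prime_nat)
qed

lemma add_self [simp]: "x + x = (0 :: 'a)"
proof -
  have "of_nat 2 = (0 :: 'a)" using of_nat_CHAR[where 'a = 'a] by (simp only: char_2)
  then have "2 * x = 0" by (simp only: of_nat_numeral mult_zero_left)
  then show ?thesis by (simp only: mult_2)
qed

lemma minus_eq [simp]: "- x = (x :: 'a)"
  using add_self[of x] by (simp only: neg_eq_iff_add_eq_0)

lemma diff_eq: "x - y = x + (y :: 'a)"
  using minus_eq[of y] by (metis diff_conv_add_uminus)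

lemma add_power: "(x + y :: 'a) ^ 2 ^ d = x ^ 2 ^ d + y ^ 2 ^ d"
  by (rule freshmans_dream') (simp_all add: char_2)

lemma frob_fixed_n: "frob_fixed n = (UNIV :: 'a set)"
  using finite_field_power_card_eq_same[where 'a = 'a] by (auto simp: frob_fixed_def card_field)

lemma subfield_frob_fixed: "subfield_set (frob_fixed d :: 'a set)"
  by (auto simp: subfield_set_def frob_fixed_def diff_eq add_power power_mult_distrib power_inverse)

lemma alpha_nz [simp]: "\<alpha> \<noteq> 0"
  using primitive by (simp add: primitive_element_def)

lemma power_order: "x \<noteq> 0 \<Longrightarrow> x ^ (2 ^ n - 1) = (1 :: 'a)"
proof -
  assume "x \<noteq> 0"
  moreover have "x * x ^ (2 ^ n - 1) = x"
    using finite_field_power_card_eq_same[of x] by (simp add: card_field flip: power_Suc)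
  ultimately show ?thesis by simp
qed

lemma alpha_power_mod: "\<alpha> ^ (i mod (2 ^ n - 1)) = \<alpha> ^ i"
proof -
  have "\<alpha> ^ i = \<alpha> ^ (i mod (2 ^ n - 1) + (2 ^ n - 1) * (i div (2 ^ n - 1)))" by simp
  also have "\<dots> = \<alpha> ^ (i mod (2 ^ n - 1))"
    by (simp only: power_add power_mult power_order[OF alpha_nz] power_one mult_1_right)
  finally show ?thesis by simp
qed

lemma order_pos: "0 < (2 ^ n - 1 :: nat)"
  using one_less_power[of "2 :: nat" n] n_pos by simp

lemma obtain_alpha_power:
  assumes "x \<noteq> 0"
  obtains i where "i < 2 ^ n - 1" "x = \<alpha> ^ i"
proof -
  obtain k where "x = \<alpha> ^ k" using assms primitive by (auto simp: primitive_element_def)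
  then show ?thesis using that[of "k mod (2 ^ n - 1)"] order_pos by (simp only: alpha_power_mod mod_less_divisor)
qed

text \<open>These \<open>2 ^ n - 1\<close> exponents reach all \<open>2 ^ n - 1\<close> nonzero
  elements, so no value is repeated.\<close>

lemma inj_on_alpha_power: "inj_on (\<lambda>i. \<alpha> ^ i) {..<2 ^ n - 1}"
proof (rule eq_card_imp_inj_on)
  have "(\<lambda>i. \<alpha> ^ i) ` {..<2 ^ n - 1} = UNIV - {0}"
    using obtain_alpha_power by (fastforce simp: image_iff)
  then show "card ((\<lambda>i. \<alpha> ^ i) ` {..<2 ^ n - 1}) = card {..<2 ^ n - 1 :: nat}"
    by (simp add: card_Diff_singleton card_field)
qed simp

lemma alpha_power_eq_1: "\<alpha> ^ m = 1 \<longleftrightarrow> 2 ^ n - 1 dvd m"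
proof
  assume "\<alpha> ^ m = 1"
  then have "\<alpha> ^ (m mod (2 ^ n - 1)) = \<alpha> ^ 0" by (simp only: alpha_power_mod power_0)
  then have "m mod (2 ^ n - 1) = 0"
    using inj_onD[OF inj_on_alpha_power] order_pos by (metis lessThan_iff mod_less_divisor)
  then show "2 ^ n - 1 dvd m" by auto
next
  assume "2 ^ n - 1 dvd m"
  then show "\<alpha> ^ m = 1" by (auto simp del: One_nat_def simp: power_mult power_order elim!: dvdE)
qed

end

section \<open>The multiplicative group of a subfield\<close>

locale binary_subfield = binary_field n \<alpha> for n :: nat and \<alpha> :: "'a::finite_field" +
  fixes d :: nat
  assumes d_dvd: "d dvd n"
begin

text \<open>The index of the multiplicative group of the subfield with \<open>2 ^ d\<close> elements
  in that of the whole field. It is the quasi-cyclic index \<open>L\<^sub>j\<close> when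
  \<open>d = u ^ (j - 1)\<close>.\<close>

definition "subgroup_index = (2 ^ n - 1 :: nat) div (2 ^ d - 1)"

lemma d_pos: "0 < d"
  using d_dvd n_pos by (auto intro: ccontr)

lemma q_gt: "0 < (2 ^ d - 1 :: nat)"
  using one_less_power[of "2 :: nat" d] d_pos by simp

lemma subgroup_index_eq_sum: "subgroup_index = (\<Sum>i<n div d. (2 ^ d) ^ i)"
  and subgroup_index_mult: "(2 ^ d - 1) * subgroup_index = 2 ^ n - 1"
proof -
  have eq: "(2 ^ d - 1) * (\<Sum>i<n div d. (2 ^ d) ^ i) = (2 ^ n - 1 :: nat)"
    using geometric_sum_nat[of "2 ^ d" "n div d"] d_dvd by (simp flip: power_mult)
  then show "subgroup_index = (\<Sum>i<n div d. (2 ^ d) ^ i)"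
    unfolding subgroup_index_def using q_gt by (metis nonzero_mult_div_cancel_left less_not_refl)
  with eq show "(2 ^ d - 1) * subgroup_index = 2 ^ n - 1" by simp
qed

lemma subgroup_index_pos: "0 < subgroup_index"
  using subgroup_index_mult order_pos by (metis mult_0_right gr0I less_not_refl)

lemma in_frob_fixed_iff:
  assumes "x \<noteq> 0"
  shows "x \<in> frob_fixed d \<longleftrightarrow> x ^ (2 ^ d - 1) = (1 :: 'a)"
proof -
  have "x ^ 2 ^ d = x * x ^ (2 ^ d - 1)" by (simp flip: power_Suc)
  then show ?thesis using assms by (simp add: frob_fixed_def)
qed

lemma alpha_power_in_frob_fixed: "\<alpha> ^ i \<in> frob_fixed d \<longleftrightarrow> subgroup_index dvd i"
proof -
  have "\<alpha> ^ i \<in> frob_fixed d \<longleftrightarrow> \<alpha> ^ ((2 ^ d - 1) * i) = 1"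
    by (simp add: in_frob_fixed_iff mult.commute flip: power_mult)
  also have "\<dots> \<longleftrightarrow> (2 ^ d - 1) * subgroup_index dvd (2 ^ d - 1) * i"
    by (simp only: alpha_power_eq_1 subgroup_index_mult)
  also have "\<dots> \<longleftrightarrow> subgroup_index dvd i" using q_gt by simp
  finally show ?thesis .
qed

definition "gen = \<alpha> ^ subgroup_index"

lemma gen_nz [simp]: "gen \<noteq> 0"
  by (simp add: gen_def)

lemma obtain_gen_power:
  assumes "y \<in> frob_fixed d" "y \<noteq> 0"
  obtains i where "i < 2 ^ d - 1" "y = gen ^ i"
proof -
  obtain i where i: "i < 2 ^ n - 1" "y = \<alpha> ^ i" using obtain_alpha_power assms(2) by blast
  then obtain j where j: "i = subgroup_index * j" using assms(1) alpha_power_in_frob_fixed by (auto elim: dvdE)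
  then have "j < 2 ^ d - 1" using i(1) by (simp del: One_nat_def flip: subgroup_index_mult)
  then show ?thesis using that[of j] i j by (simp add: gen_def power_mult)
qed

lemma gen_in: "gen \<in> frob_fixed d"
  by (simp add: gen_def alpha_power_in_frob_fixed)

lemma card_frob_fixed: "card (frob_fixed d :: 'a set) = 2 ^ d"
proof -
  have "inj_on (\<lambda>i. gen ^ i) {..<2 ^ d - 1}"
  proof (rule inj_onI)
    fix i j assume *: "i \<in> {..<2 ^ d - 1 :: nat}" "j \<in> {..<2 ^ d - 1}" "gen ^ i = gen ^ j"
    have "subgroup_index * k < 2 ^ n - 1" if "k < 2 ^ d - 1" for k
      using that subgroup_index_pos by (simp del: One_nat_def flip: subgroup_index_mult)
    then have "subgroup_index * i = subgroup_index * j"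
      using inj_onD[OF inj_on_alpha_power, of "subgroup_index * i" "subgroup_index * j"] *
      by (simp add: gen_def power_mult)
    then show "i = j" using subgroup_index_pos by simp
  qed
  then have c: "card ((\<lambda>i. gen ^ i) ` {..<2 ^ d - 1}) = 2 ^ d - 1" by (simp add: card_image)
  have "gen ^ i \<in> frob_fixed d" for i
    by (induction i) (use subfield_setD[OF subfield_frob_fixed] gen_in in auto)
  then have "frob_fixed d = insert 0 ((\<lambda>i. gen ^ i) ` {..<2 ^ d - 1})"
    using subfield_setD(1)[OF subfield_frob_fixed] obtain_gen_power by (auto simp: image_iff) blast
  then have "card (frob_fixed d :: 'a set) = Suc (2 ^ d - 1)"
    using c by (simp add: card_insert_if image_iff)
  then show ?thesis by simp
qed

lemma card_subspaces_frob_fixed: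
  "real (card (subspaces (frob_fixed d :: 'a set))) = 1 + num_subspaces (n div d) (2 ^ d)"
  using card_subspaces[OF subfield_frob_fixed[of d], of "n div d"] d_dvd
  by (simp add: card_frob_fixed card_field flip: power_mult)

text \<open>The element \<open>x ^ (2 ^ d - 1)\<close> is 1 exactly when a nonzero \<open>x\<close>
  lies in the subfield. Both its third power and its power with exponent
  \<open>subgroup_index\<close> are 1, and these exponents are coprime.\<close>

lemma cube_in_frob_fixed:
  assumes 3: "\<not> 3 dvd subgroup_index" and x: "x ^ 3 \<in> (frob_fixed d :: 'a set)"
  shows "x \<in> frob_fixed d"
proof (cases "x = 0")
  case True
  then show ?thesis using subfield_setD(1)[OF subfield_frob_fixed] by simp
next
  case False
  define y where "y = x ^ (2 ^ d - 1)"
  have "y ^ 3 = (x ^ 3) ^ (2 ^ d - 1)" by (simp add: y_def mult.commute flip: power_mult)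
  then have y3: "y ^ 3 = 1" using x False in_frob_fixed_iff[of "x ^ 3"] by simp
  have "y ^ subgroup_index = 1"
    using power_order[OF False] by (simp only: y_def subgroup_index_mult flip: power_mult)
  moreover have "y ^ subgroup_index = y ^ (3 * (subgroup_index div 3) + subgroup_index mod 3)" by simp
  ultimately have ym: "y ^ (subgroup_index mod 3) = 1"
    by (simp only: power_add power_mult y3) simp
  have "subgroup_index mod 3 = 1 \<or> subgroup_index mod 3 = 2" using 3 by presburger
  then have "y = 1"
  proof
    assume "subgroup_index mod 3 = 2"
    then have "y * y ^ 2 = y" using ym by simp
    moreover have "y * y ^ 2 = y ^ 3" by (simp add: power2_eq_square power3_eq_cube)
    ultimately show ?thesis using y3 by simp
  qed (use ym in simp)
  then show ?thesis using False in_frob_fixed_iff by (simp add: y_def)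
qed

end

section \<open>Classification of the subfields and the field of multipliers of an additive
  group\<close>

context binary_field
begin

text \<open>A basis of the whole field over \<open>K\<close> makes \<open>2 ^ n\<close> a power of
  \<open>card K\<close>, so \<open>card K = 2 ^ e\<close> with \<open>e\<close> dividing
  \<open>n\<close>; the size then determines \<open>K\<close>.\<close>

lemma subfield_eq_frob_fixed:
  assumes K: "subfield_set (K :: 'a set)"
  obtains e where "e dvd n" "K = frob_fixed e"
proof -
  have "UNIV \<in> subspaces K" by (simp add: subspaces_def)
  then obtain xs where xs: "list_indep K xs" "list_span K xs = UNIV" by (rule subspace_has_basis[OF K])
  then have eq: "card K ^ length xs = 2 ^ n" using card_list_span[OF K] card_field by metis
  then have "length xs \<noteq> 0" using power_gt1_lemma[of "2 :: nat" "n - 1"] n_pos by (intro notI) (auto simp: power_eq_if)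
  then have "card K dvd 2 ^ n" using eq by (metis dvd_power not_gr_zero)
  then obtain e where e: "card K = 2 ^ e" by (auto simp: divides_primepow_nat)
  then have "(2 :: nat) ^ (e * length xs) = 2 ^ n" using eq by (simp add: power_mult)
  then have "n = e * length xs" by (metis power_inject_exp one_less_numeral_iff semiring_norm(76))
  then show ?thesis using that[of e] subfield_eq_power_fixed[OF K] e by (auto simp: frob_fixed_def)
qed

text \<open>The inverse of a nonzero \<open>x\<close> is the power \<open>x ^ (2 ^ n - 2)\<close>,
  and subtraction is addition.\<close>

lemma subring_imp_subfield:
  assumes "0 \<in> R" "1 \<in> R" "\<And>x y. x \<in> R \<Longrightarrow> y \<in> R \<Longrightarrow> x + y \<in> R"
    "\<And>x y. x \<in> R \<Longrightarrow> y \<in> R \<Longrightarrow> x * y \<in> (R :: 'a set)"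
  shows "subfield_set R"
proof -
  have "inverse x \<in> R" if "x \<in> R" for x
  proof (cases "x = 0")
    case False
    have "x * x ^ (2 ^ n - 2) = x ^ (2 ^ n - 1)"
      using order_pos by (simp flip: power_Suc add: Suc_diff_Suc numeral_2_eq_2)
    then have "inverse x = x ^ (2 ^ n - 2)"
      using power_order[OF False] by (simp add: inverse_unique)
    moreover have "x ^ k \<in> R" for k by (induction k) (use assms that in auto)
    ultimately show ?thesis by simp
  qed (use assms in simp)
  then show ?thesis using assms by (simp add: subfield_set_def diff_eq)
qed

text \<open>The multipliers of an additive group are closed under sums and products. Being a field,
  they contain with one element the whole subfield that it generates.\<close>

lemma multiplier_subfield:
  assumes "0 \<in> V" "\<And>x y. x \<in> V \<Longrightarrow> y \<in> V \<Longrightarrow> x + y \<in> (V :: 'a set)"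
  obtains e where "e dvd n" "{r. \<forall>v\<in>V. r * v \<in> V} = frob_fixed e"
proof (rule subfield_eq_frob_fixed)
  show "subfield_set {r. \<forall>v\<in>V. r * v \<in> V}"
    by (rule subring_imp_subfield) (use assms in \<open>auto simp: algebra_simps\<close>)
qed

text \<open>The subfields of a field of degree \<open>u ^ b\<close> form a chain, so a multiplier outside
  one of them generates a field that contains the next one.\<close>

lemma closed_under_next_subfield:
  assumes u: "prime u" and n: "n = u ^ b" and "k < b"
    and V: "0 \<in> V" "\<And>v w. v \<in> V \<Longrightarrow> w \<in> V \<Longrightarrow> v + w \<in> V"
    and x: "\<And>v. v \<in> V \<Longrightarrow> x * v \<in> V" "x \<notin> frob_fixed (u ^ k)"
  shows "V \<in> subspaces (frob_fixed (u ^ Suc k) :: 'a set)"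
proof -
  obtain e where e: "e dvd n" "{r. \<forall>v\<in>V. r * v \<in> V} = frob_fixed e"
    using multiplier_subfield[of V] V by blast
  then obtain i where i: "e = u ^ i" using u n by (auto simp: divides_primepow_nat)
  have "x \<in> frob_fixed e" using x(1) e(2) by blast
  then have "\<not> u ^ i dvd u ^ k" using x(2) frob_fixed_mono i by blast
  then have "Suc k \<le> i" by (meson le_imp_power_dvd not_less_eq_eq)
  then have "frob_fixed (u ^ Suc k) \<subseteq> frob_fixed e"
    unfolding i by (intro frob_fixed_mono le_imp_power_dvd)
  then show ?thesis using V e(2) by (auto simp: subspaces_def)
qed

end

subsection \<open>Pairs under multiplication by \<open>(x, x ^ 3)\<close>\<close>

text \<open>The only scalars are 0 and 1, so additive closure together with the zero vector already
  gives closure under scalars.\<close>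

lemma linear_code_iff:
  "linear_code N D \<longleftrightarrow> D \<subseteq> carrier_vec N \<and> 0\<^sub>v N \<in> D \<and> (\<forall>v\<in>D. \<forall>w\<in>D. v + w \<in> D)"
proof -
  interpret vec_space "TYPE(bit)" N .
  have "c \<cdot>\<^sub>v v \<in> D" if "0\<^sub>v N \<in> D" "v \<in> D" "D \<subseteq> carrier_vec N" for c :: bit and v
  proof (cases c)
    case zero
    then have "c \<cdot>\<^sub>v v = 0\<^sub>v N" using that by (intro eq_vecI) auto
    then show ?thesis using that by simp
  next
    case one
    then show ?thesis using that by simp
  qed
  then show ?thesis
    using module_axioms vectorspace_axioms
    by (auto simp: linear_code_def VectorSpace.subspace_def submodule_def module_vec_simps class_ring_simps)
qed

text \<open>For \<open>x = \<alpha> ^ l\<close> this is the effect of a cyclic shift by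
  \<open>l\<close> positions on the pair that defines a codeword; see
  \<open>cyclic_shift_encode\<close>.\<close>

definition cube_act :: "'a::field \<Rightarrow> 'a \<times> 'a \<Rightarrow> 'a \<times> 'a" where
  "cube_act x p = (x * fst p, x ^ 3 * snd p)"

text \<open>In characteristic two these are the modules over the binary polynomial ring whose
  variable acts as \<open>cube_act x\<close>.\<close>

definition cube_modules :: "'a::field \<Rightarrow> ('a \<times> 'a) set set" where
  "cube_modules x = {W. 0 \<in> W \<and> (\<forall>p\<in>W. \<forall>q\<in>W. p + q \<in> W) \<and> (\<forall>p\<in>W. cube_act x p \<in> W)}"

lemma cube_modulesD:
  assumes "W \<in> cube_modules x"
  shows "0 \<in> W" "\<And>p q. p \<in> W \<Longrightarrow> q \<in> W \<Longrightarrow> p + q \<in> W" "\<And>p. p \<in> W \<Longrightarrow> cube_act x p \<in> W"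
  using assms by (auto simp: cube_modules_def)

lemma times_in_cube_modules:
  assumes "V \<in> subspaces K" "V' \<in> subspaces K'" "x \<in> K" "x ^ 3 \<in> K'"
  shows "V \<times> V' \<in> cube_modules x"
  using assms by (auto simp: cube_modules_def cube_act_def zero_prod_def dest: subspacesD)

lemma zero_in_cube_modules: "{0} \<in> cube_modules x"
  by (simp add: cube_modules_def cube_act_def zero_prod_def)

lemma cube_act_mult: "cube_act (x * y) p = cube_act x (cube_act y p)"
  by (simp add: cube_act_def power_mult_distrib)

lemma cube_modules_power: "cube_modules x \<subseteq> cube_modules (x ^ k)"
proof
  fix W assume W: "W \<in> cube_modules x"
  have "cube_act (x ^ k) p \<in> W" if "p \<in> W" for p
    using that
  proof (induction k)
    case 0
    then show ?case by (simp add: cube_act_def)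
  next
    case (Suc k)
    then show ?case using cube_modulesD(3)[OF W] by (simp add: cube_act_mult)
  qed
  then show "W \<in> cube_modules (x ^ k)" using W by (simp add: cube_modules_def)
qed

section \<open>From codewords and shifts to pairs\<close>

context binary_field
begin

lemma cube_add_one: "(y + 1) ^ 3 + y ^ 3 + 1 = y * (y + 1 :: 'a)"
proof -
  have "(y + 1) ^ 2 = y ^ 2 + 1" using add_power[of y 1 1] by simp
  then have "(y + 1) ^ 3 = (y + 1) * (y ^ 2 + 1)" by (simp add: power3_eq_cube power2_eq_square mult.assoc)
  also have "\<dots> = y ^ 3 + y * (y + 1) + 1" by (simp add: power3_eq_cube power2_eq_square algebra_simps)
  finally have "(y + 1) ^ 3 + y ^ 3 + 1 = (y ^ 3 + y ^ 3) + (1 + 1) + y * (y + 1)"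
    by (simp only: ac_simps)
  then show ?thesis by simp
qed

lemma trace_add: "trace n (x + y :: 'a) = trace n x + trace n y"
proof -
  have "trace_sum n (x + y) = trace_sum n x + trace_sum n y"
    by (simp add: trace_sum_def add_power sum.distrib)
  then have "of_bool (trace n (x + y) = 1) = (of_bool (trace n x = 1) + of_bool (trace n y = 1) :: 'a)"
    by (simp only: of_bool_trace[OF card_field])
  then show ?thesis
    by (cases "trace n x"; cases "trace n y"; cases "trace n (x + y)") auto
qed

lemma trace_0: "trace n (0 :: 'a) = 0"
  using trace_add[of 0 0] by simp

text \<open>The trace is given by a polynomial of degree at most \<open>2 ^ (n - 1)\<close> whose
  coefficient of X is 1, so it cannot vanish at all \<open>2 ^ n\<close> elements.\<close>

lemma trace_nontrivial: "\<exists>x :: 'a. trace n x \<noteq> 0"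
proof (rule ccontr)
  assume "\<not> ?thesis"
  then have 0: "trace_sum n x = 0" for x :: 'a
    using of_bool_trace[OF card_field, of x] by simp
  let ?p = "\<Sum>i<n. Polynomial.monom 1 (2 ^ i) :: 'a poly"
  have "Polynomial.coeff ?p 1 = (\<Sum>i<n. if i = 0 then 1 else 0)"
    by (simp add: coeff_sum)
  then have "Polynomial.coeff ?p 1 \<noteq> 0" using n_pos by simp
  then have nz: "?p \<noteq> 0" by (metis coeff_0)
  have "Polynomial.degree ?p \<le> 2 ^ (n - 1)"
    using n_pos by (intro degree_sum_le) (auto intro!: order.trans[OF degree_monom_le] power_increasing)
  moreover have "card {x :: 'a. poly ?p x = 0} \<le> Polynomial.degree ?p"
    by (rule card_poly_roots_bound[OF nz])
  moreover have "{x :: 'a. poly ?p x = 0} = UNIV"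
    using 0 by (simp add: poly_sum poly_monom trace_sum_def)
  ultimately have "(2 :: nat) ^ n \<le> 2 ^ (n - 1)"
    unfolding card_field[symmetric] by (metis order.trans)
  then show False using n_pos by (simp add: power_increasing_iff)
qed

definition encode :: "'a \<times> 'a \<Rightarrow> bit vec" where
  "encode p = vec (2 ^ n - 1) (\<lambda>k. trace n (fst p * \<alpha> ^ k + snd p * \<alpha> ^ (3 * k)))"

lemma dim_encode [simp]: "dim_vec (encode p) = 2 ^ n - 1"
  by (simp add: encode_def)

lemma dual_bch_eq_range: "dual_bch n \<alpha> = range encode"
  unfolding dual_bch_def encode_def full_SetCompr_eq[symmetric] by simp

lemma encode_add: "encode (p + q) = encode p + encode q"
proof (intro eq_vecI)
  fix k assume "k < dim_vec (encode p + encode q)"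
  then have k: "k < 2 ^ n - 1" by simp
  show "encode (p + q) $ k = (encode p + encode q) $ k"
    unfolding encode_def using k
    by (simp only: index_vec index_add_vec dim_vec fst_add snd_add distrib_right trace_add
        add.assoc add.left_commute)
qed simp

lemma encode_0: "encode 0 = 0\<^sub>v (2 ^ n - 1)"
  by (intro eq_vecI) (simp_all add: encode_def trace_0)

text \<open>The wrap-around of positions is harmless because exponents of \<open>\<alpha>\<close>
  matter only modulo the code length \<open>2 ^ n - 1\<close>.\<close>

lemma cyclic_shift_encode: "cyclic_shift l (encode p) = encode (cube_act (\<alpha> ^ l) p)"
proof (intro eq_vecI)
  fix k assume "k < dim_vec (encode (cube_act (\<alpha> ^ l) p))"
  then have k: "k < 2 ^ n - 1" by simp
  let ?r = "(k + l) mod (2 ^ n - 1)"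
  have r: "?r < 2 ^ n - 1" using order_pos by simp
  have c: "\<alpha> ^ (3 * ?r) = \<alpha> ^ (3 * (k + l))"
    by (simp only: mult.commute[of 3] power_mult alpha_power_mod)
  have "cyclic_shift l (encode p) $ k = encode p $ ?r"
    using k by (simp add: cyclic_shift_def)
  also have "\<dots> = trace n (fst p * \<alpha> ^ (k + l) + snd p * \<alpha> ^ (3 * (k + l)))"
    unfolding encode_def using r by (simp only: index_vec alpha_power_mod c)
  also have "\<dots> = encode (cube_act (\<alpha> ^ l) p) $ k"
    using k by (simp add: encode_def cube_act_def power_add distrib_left ac_simps flip: power_mult)
  finally show "cyclic_shift l (encode p) $ k = encode (cube_act (\<alpha> ^ l) p) $ k" .
qed (simp add: cyclic_shift_def)

lemma linear_code_encode_image: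
  assumes "inj encode"
  shows "linear_code (2 ^ n - 1) (encode ` W) \<longleftrightarrow> 0 \<in> W \<and> (\<forall>p\<in>W. \<forall>q\<in>W. p + q \<in> W)"
proof -
  have "encode ` W \<subseteq> carrier_vec (2 ^ n - 1)" by (intro image_subsetI carrier_vecI) simp
  then show ?thesis
    unfolding linear_code_iff
    by (simp only: ball_simps encode_0[symmetric] encode_add[symmetric] inj_image_mem_iff[OF assms] simp_thms)
qed

lemma shift_invariant_encode_image:
  assumes "inj encode"
  shows "shift_invariant l (encode ` W) \<longleftrightarrow> (\<forall>p\<in>W. cube_act (\<alpha> ^ l) p \<in> W)"
  unfolding shift_invariant_def using inj_image_mem_iff[OF assms]
  by (auto simp: cyclic_shift_encode)

lemma qc_subcodes_encode:
  assumes inj: "inj encode" and "0 < l"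
  shows "qc_subcodes (2 ^ n - 1) l (range encode) =
    (\<lambda>W. encode ` W) ` {W \<in> cube_modules (\<alpha> ^ l) - {{0}}. \<forall>m. 0 < m \<and> m < l \<longrightarrow> W \<notin> cube_modules (\<alpha> ^ m)}"
    (is "_ = _ ` ?S")
proof -
  have mem: "encode ` W \<in> qc_subcodes (2 ^ n - 1) l (range encode) \<longleftrightarrow> W \<in> ?S" for W
  proof -
    have zero: "encode ` W = {0\<^sub>v (2 ^ n - 1)} \<longleftrightarrow> W = {0}"
      using inj_image_eq_iff[OF inj, of W "{0}"] by (simp add: encode_0)
    have mod: "W \<in> cube_modules (\<alpha> ^ m) \<longleftrightarrow>
        linear_code (2 ^ n - 1) (encode ` W) \<and> shift_invariant m (encode ` W)" for m
      unfolding linear_code_encode_image[OF inj] shift_invariant_encode_image[OF inj]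
      by (simp only: cube_modules_def mem_Collect_eq conj_assoc)
    have sub: "encode ` W \<subseteq> range encode" by auto
    \<comment> \<open>Linearity \<open>L\<close> does not depend on the shift, so it may be attached
      to every negated invariance; this turns minimality of the index into non-membership in the
      smaller \<open>cube_modules\<close>.\<close>
    have "S \<and> Z \<and> L \<and> 0 < l \<and> I l \<and> (\<forall>m. 0 < m \<and> m < l \<longrightarrow> \<not> I m) \<longleftrightarrow>
        ((L \<and> I l) \<and> Z) \<and> (\<forall>m. 0 < m \<and> m < l \<longrightarrow> \<not> (L \<and> I m))" if S for S Z L I
      using that \<open>0 < l\<close> by auto
    from this[OF sub] show ?thesis
      unfolding qc_subcodes_def quasi_cyclic_def mem_Collect_eq Diff_iff singleton_iff zero mod .
  qed
  show ?thesis
  proof (intro equalityI subsetI)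
    fix D assume D: "D \<in> qc_subcodes (2 ^ n - 1) l (range encode)"
    then have "D \<subseteq> range encode" unfolding qc_subcodes_def by blast
    then obtain W where "D = encode ` W" by (rule subset_imageE)
    then show "D \<in> (\<lambda>W. encode ` W) ` ?S" using D mem[of W] by blast
  next
    fix D assume "D \<in> (\<lambda>W. encode ` W) ` ?S"
    then obtain W where "W \<in> ?S" "D = encode ` W" by (rule imageE)
    then show "D \<in> qc_subcodes (2 ^ n - 1) l (range encode)" using mem[of W] by (simp only:)
  qed
qed

lemma card_qc_subcodes:
  assumes "inj encode" "0 < l"
  shows "card (qc_subcodes (2 ^ n - 1) l (range encode)) =
    card {W \<in> cube_modules (\<alpha> ^ l) - {{0}}. \<forall>m. 0 < m \<and> m < l \<longrightarrow> W \<notin> cube_modules (\<alpha> ^ m)}"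
  unfolding qc_subcodes_encode[OF assms]
  by (rule card_image) (auto intro!: inj_onI dest: inj_image_eq_iff[OF assms(1), THEN iffD1])

end

section \<open>Splitting an invariant group of pairs into a product\<close>

context binary_subfield
begin

lemma gen_power_eq_1: "gen ^ m = 1 \<longleftrightarrow> 2 ^ d - 1 dvd m"
proof -
  have "gen ^ m = 1 \<longleftrightarrow> (2 ^ d - 1) * subgroup_index dvd m * subgroup_index"
    by (simp only: gen_def alpha_power_eq_1 subgroup_index_mult mult.commute[of m] flip: power_mult)
  then show ?thesis using subgroup_index_pos by simp
qed

lemma cube_act_frob_fixed:
  assumes W: "W \<in> cube_modules gen" and "y \<in> frob_fixed d" "p \<in> W"
  shows "cube_act y p \<in> W"
proof (cases "y = 0")
  case True
  then show ?thesis using cube_modulesD(1)[OF W] by (simp add: cube_act_def zero_prod_def)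
next
  case False
  then obtain i where "y = gen ^ i" using assms(2) obtain_gen_power by blast
  then show ?thesis
    using cube_modulesD(3) cube_modules_power[of gen i] W assms(3) by blast
qed

lemma gen_closed_imp_subspace:
  assumes "0 \<in> V" "\<And>x y. x \<in> V \<Longrightarrow> y \<in> V \<Longrightarrow> x + y \<in> V" "\<And>x. x \<in> V \<Longrightarrow> gen * x \<in> V"
  shows "V \<in> subspaces (frob_fixed d)"
proof -
  have p: "gen ^ i * x \<in> V" if "x \<in> V" for i x
    by (induction i) (use that assms(3) in \<open>auto simp: mult.assoc\<close>)
  have "c * x \<in> V" if c: "c \<in> frob_fixed d" and x: "x \<in> V" for c x
  proof (cases "c = 0")
    case False
    then obtain i where "c = gen ^ i" using obtain_gen_power[OF c] by blast
    then show ?thesis using p[OF x] by simp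
  qed (use assms(1) in simp)
  then show ?thesis unfolding subspaces_def using assms(1,2) by blast
qed

text \<open>Cubing is not additive on a field with more than two elements: for \<open>y \<noteq> 0, 1\<close> the actions
  of \<open>y + 1\<close>, \<open>y\<close> and \<open>1\<close> add up to \<open>0\<close> on the first component, but to a unit on the second.\<close>

lemma cube_module_splits:
  assumes W: "W \<in> cube_modules gen" and d: "2 \<le> d" and ab: "(a, b) \<in> W"
  shows "(a, 0) \<in> W" "(0, b) \<in> W"
proof -
  have "frob_fixed d \<noteq> ({0, 1} :: 'a set)"
  proof
    assume "frob_fixed d = ({0, 1} :: 'a set)"
    then have "2 ^ d = card {0, 1 :: 'a}" using card_frob_fixed by simp
    then have "2 ^ d = (2 ^ 1 :: nat)" by simp
    then show False using d by (simp only: power_inject_exp)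
  qed
  then obtain y :: 'a where y: "y \<in> frob_fixed d" "y \<noteq> 0" "y \<noteq> 1"
    using subfield_setD(1,2)[OF subfield_frob_fixed[of d]] by blast
  define z where "z = y * (y + 1)"
  have y1: "y + 1 \<in> frob_fixed d"
    using y subfield_setD(2,4)[OF subfield_frob_fixed[of d]] by blast
  have "y + 1 \<noteq> 0" using y(3) by (simp flip: diff_eq)
  then have z: "z \<noteq> 0" "z \<in> frob_fixed d"
    using y y1 subfield_setD(5)[OF subfield_frob_fixed[of d]] by (auto simp: z_def)
  have step: "(0, z * f) \<in> W" if "(e, f) \<in> W" for e f
  proof -
    have "cube_act (y + 1) (e, f) + cube_act y (e, f) + (e, f) \<in> W"
      using that y y1 cube_act_frob_fixed[OF W] cube_modulesD(2)[OF W] by blast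
    also have "cube_act (y + 1) (e, f) + cube_act y (e, f) + (e, f) =
        ((y * e + y * e) + (e + e), ((y + 1) ^ 3 + y ^ 3 + 1) * f)"
      by (simp only: cube_act_def fst_conv snd_conv plus_prod_def distrib_right mult_1_left
          add.assoc add.left_commute add.commute)
    finally show ?thesis by (simp only: cube_add_one add_self z_def add_0)
  qed
  \<comment> \<open>Iterating \<open>step\<close> reaches the exponent \<open>2 ^ d - 1\<close>,
    where the power of \<open>z\<close> is 1; this removes the unit in front of
    \<open>b\<close>.\<close>
  have "(0, z ^ Suc k * b) \<in> W" for k
    by (induction k) (use step[OF ab] step in \<open>auto simp: mult.assoc\<close>)
  moreover have "Suc (2 ^ d - 2) = 2 ^ d - 1" using q_gt by linarith
  ultimately have "(0, z ^ (2 ^ d - 1) * b) \<in> W" by metis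
  then show b: "(0, b) \<in> W" using z in_frob_fixed_iff by simp
  then show "(a, 0) \<in> W" using cube_modulesD(2)[OF W ab] by fastforce
qed

text \<open>For the second factor only closure under \<open>gen ^ 3\<close> is recorded, since the
  subfield generated by that cube may be smaller than \<open>frob_fixed d\<close>.\<close>

lemma cube_module_eq_times:
  assumes W: "W \<in> cube_modules gen" and d: "2 \<le> d"
  defines "V\<^sub>1 \<equiv> {a. (a, 0) \<in> W}" and "V\<^sub>2 \<equiv> {b. (0, b) \<in> W}"
  shows "W = V\<^sub>1 \<times> V\<^sub>2" "V\<^sub>1 \<in> subspaces (frob_fixed d)" "0 \<in> V\<^sub>2"
    "\<And>x y. x \<in> V\<^sub>2 \<Longrightarrow> y \<in> V\<^sub>2 \<Longrightarrow> x + y \<in> V\<^sub>2" "\<And>y. y \<in> V\<^sub>2 \<Longrightarrow> gen ^ 3 * y \<in> V\<^sub>2"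
proof -
  show "W = V\<^sub>1 \<times> V\<^sub>2"
    using cube_module_splits[OF W d] cube_modulesD(2)[OF W] unfolding V\<^sub>1_def V\<^sub>2_def by fastforce
  show "V\<^sub>1 \<in> subspaces (frob_fixed d)"
  proof (rule gen_closed_imp_subspace)
    show "0 \<in> V\<^sub>1" using cube_modulesD(1)[OF W] by (simp add: V\<^sub>1_def zero_prod_def)
    show "x + y \<in> V\<^sub>1" if "x \<in> V\<^sub>1" "y \<in> V\<^sub>1" for x y
      using cube_modulesD(2)[OF W, of "(x, 0)" "(y, 0)"] that by (simp add: V\<^sub>1_def)
    show "gen * x \<in> V\<^sub>1" if "x \<in> V\<^sub>1" for x
      using cube_modulesD(3)[OF W, of "(x, 0)"] that by (simp add: V\<^sub>1_def cube_act_def)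
  qed
  show "0 \<in> V\<^sub>2" using cube_modulesD(1)[OF W] by (simp add: V\<^sub>2_def zero_prod_def)
  show "x + y \<in> V\<^sub>2" if "x \<in> V\<^sub>2" "y \<in> V\<^sub>2" for x y
    using cube_modulesD(2)[OF W, of "(0, x)" "(0, y)"] that by (simp add: V\<^sub>2_def)
  show "gen ^ 3 * y \<in> V\<^sub>2" if "y \<in> V\<^sub>2" for y
    using cube_modulesD(3)[OF W, of "(0, y)"] that by (simp add: V\<^sub>2_def cube_act_def)
qed

end

text \<open>A product of nonempty sets determines its factors.\<close>

lemma card_times_image:
  assumes "\<And>V. V \<in> A \<Longrightarrow> V \<noteq> {}" "\<And>V. V \<in> B \<Longrightarrow> V \<noteq> {}"
  shows "card ((\<lambda>(V, V'). V \<times> V') ` (A \<times> B)) = card A * card B"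
proof -
  have "inj_on (\<lambda>(V, V'). V \<times> V') (A \<times> B)"
    using assms by (auto simp: inj_on_def times_eq_iff)
  then show ?thesis by (simp add: card_image card_cartesian_product)
qed

subsection \<open>Counting quasi-cyclic subcodes\<close>

text \<open>Here \<open>b\<close> stands for \<open>a - 1\<close>. The bound on \<open>n\<close>
  excludes the field with four elements, where all cubes lie in the prime field and distinct pairs
  can give the same codeword.\<close>

locale prime_power_bch = binary_field n \<alpha> for n :: nat and \<alpha> :: "'a::finite_field" +
  fixes u b :: nat
  assumes prime_u: "prime u" and n_eq: "n = u ^ b" and n_ge: "3 \<le> n"
begin

lemma binary_subfield: "k \<le> b \<Longrightarrow> binary_subfield n \<alpha> (u ^ k)"
  by unfold_locales (simp add: n_eq le_imp_power_dvd)

text \<open>This is \<open>L\<^sub>j\<close> for \<open>j = k + 1\<close>, numbered by the level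
  \<open>k\<close> of the subfield of degree \<open>u ^ k\<close>.\<close>

definition qc_ind :: "nat \<Rightarrow> nat" where
  "qc_ind k = (2 ^ n - 1) div (2 ^ u ^ k - 1)"

lemma qc_ind_eq: "k \<le> b \<Longrightarrow> qc_ind k = binary_subfield.subgroup_index n (u ^ k)"
  using binary_subfield.subgroup_index_def[OF binary_subfield] by (simp add: qc_ind_def)

lemma gen_eq: "k \<le> b \<Longrightarrow> binary_subfield.gen n \<alpha> (u ^ k) = \<alpha> ^ qc_ind k"
  using binary_subfield.gen_def[OF binary_subfield] by (simp add: qc_ind_eq)

lemma qc_ind_pos: "k \<le> b \<Longrightarrow> 0 < qc_ind k"
  using binary_subfield.subgroup_index_pos[OF binary_subfield] by (simp add: qc_ind_eq)

lemma u_ge: "2 \<le> u"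
  using prime_u by (rule prime_ge_2_nat)

lemma pow_ge_2: "1 \<le> k \<Longrightarrow> 2 \<le> u ^ k"
  using u_ge power_increasing[of 1 k u] by simp

lemma qc_ind_less:
  assumes "k < b"
  shows "qc_ind (Suc k) < qc_ind k"
proof -
  have "u ^ k < u ^ Suc k" using u_ge by (simp add: power_strict_increasing_iff)
  then have "(2 :: nat) ^ u ^ k < 2 ^ u ^ Suc k" by (rule power_strict_increasing) simp
  moreover have "1 < (2 :: nat) ^ u ^ k" using u_ge by (intro one_less_power) auto
  ultimately have "2 ^ u ^ k - 1 < (2 ^ u ^ Suc k - 1 :: nat)" by linarith
  then have "(2 ^ u ^ k - 1) * qc_ind (Suc k) < (2 ^ u ^ Suc k - 1) * qc_ind (Suc k)"
    using qc_ind_pos[of "Suc k"] assms by simp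
  also have "\<dots> = (2 ^ u ^ k - 1) * qc_ind k"
    using binary_subfield.subgroup_index_mult[OF binary_subfield] assms
    by (simp only: qc_ind_eq less_imp_le Suc_le_eq)
  finally show ?thesis by simp
qed

text \<open>For odd \<open>u\<close> the exponent \<open>n\<close> is odd, so 3 does not even divide
  \<open>2 ^ n - 1\<close>. For \<open>u = 2\<close> and \<open>k \<ge> 1\<close>,
  \<open>2 ^ u ^ k\<close> is 1 modulo 3, so the geometric sum is congruent to its number of terms,
  a power of two.\<close>

lemma not_3_dvd_qc_ind:
  assumes k: "1 \<le> k" "k \<le> b"
  shows "\<not> 3 dvd qc_ind k"
proof (cases "odd u")
  case True
  then have "odd n" by (simp add: n_eq)
  then obtain m where m: "n = 2 * m + 1" by (rule oddE)
  have "(4 :: nat) ^ m mod 3 = 1" using power_mod[of "4 :: nat" 3 m] by simp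
  then have "2 * (4 :: nat) ^ m mod 3 = 2" by presburger
  then have "(2 :: nat) ^ n mod 3 = 2" by (simp add: m power_add power_mult)
  then have "\<not> 3 dvd (2 ^ n - 1 :: nat)" by presburger
  moreover have "qc_ind k dvd 2 ^ n - 1"
    using binary_subfield.subgroup_index_mult[OF binary_subfield[OF k(2)]] qc_ind_eq[OF k(2)]
    by (metis dvd_triv_right)
  ultimately show ?thesis by (meson dvd_trans)
next
  case False
  then have u: "u = 2" using prime_u primes_dvd_imp_eq two_is_prime_nat by blast
  obtain l where l: "k = Suc l" using k by (cases k) auto
  have "(4 :: nat) ^ 2 ^ l mod 3 = 1" using power_mod[of "4 :: nat" 3 "2 ^ l"] by simp
  then have q: "(2 :: nat) ^ u ^ k mod 3 = 1" by (simp add: u l power_mult)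
  have "qc_ind k = (\<Sum>i<n div u ^ k. (2 ^ u ^ k) ^ i)"
    using binary_subfield.subgroup_index_eq_sum[OF binary_subfield[OF k(2)]] qc_ind_eq[OF k(2)] by simp
  also have "\<dots> mod 3 = (\<Sum>i<n div u ^ k. ((2 ^ u ^ k) mod 3) ^ i mod 3) mod 3"
    by (simp only: mod_sum_eq power_mod)
  also have "\<dots> = (n div u ^ k) mod 3" unfolding q by simp
  also have "n div u ^ k = 2 ^ (b - k)" using k by (simp add: n_eq u power_diff)
  finally have "3 dvd qc_ind k \<longleftrightarrow> 3 dvd (2 :: nat) ^ (b - k)" by (simp add: dvd_eq_mod_eq_0)
  moreover have "\<not> 3 dvd (2 :: nat) ^ (b - k)"
  proof
    assume "3 dvd (2 :: nat) ^ (b - k)"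
    then have "(3 :: nat) dvd 2" by (rule prime_dvd_power[rotated]) simp
    then show False by presburger
  qed
  ultimately show ?thesis by simp
qed

text \<open>Otherwise the order of the generator would divide \<open>3 * (2 ^ u ^ k - 1)\<close>,
  which is too small.\<close>

lemma gen_cube_notin:
  assumes k: "Suc k \<le> b" "u ^ Suc k \<noteq> 2"
  shows "binary_subfield.gen n \<alpha> (u ^ Suc k) ^ 3 \<notin> frob_fixed (u ^ k)"
proof
  interpret s: binary_subfield n \<alpha> "u ^ Suc k" by (rule binary_subfield[OF k(1)])
  interpret t: binary_subfield n \<alpha> "u ^ k" using k(1) by (intro binary_subfield) simp
  assume "s.gen ^ 3 \<in> frob_fixed (u ^ k)"
  then have "s.gen ^ (3 * (2 ^ u ^ k - 1)) = 1"
    using t.in_frob_fixed_iff[OF power_not_zero[OF s.gen_nz], of 3] by (simp only: power_mult)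
  then have "2 ^ u ^ Suc k - 1 dvd 3 * (2 ^ u ^ k - 1 :: nat)"
    by (simp only: s.gen_power_eq_1)
  then have le: "2 ^ u ^ Suc k - 1 \<le> 3 * (2 ^ u ^ k - 1 :: nat)"
    using t.q_gt by (intro dvd_imp_le) simp_all
  have "2 * u ^ k \<le> u ^ Suc k" using u_ge by simp
  moreover have "3 \<le> u ^ Suc k" using pow_ge_2[of "Suc k"] k(2) by simp
  \<comment> \<open>A gap of two between the degrees yields a factor 4, which beats the factor 3
    from cubing. Only the field with four elements has a smaller gap.\<close>
  ultimately have "u ^ k + 2 \<le> u ^ Suc k" by linarith
  then have "(2 :: nat) ^ (u ^ k + 2) \<le> 2 ^ u ^ Suc k" by (rule power_increasing) simp
  then have "4 * (2 :: nat) ^ u ^ k \<le> 2 ^ u ^ Suc k" by (simp add: power_add)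
  with le t.q_gt show False by linarith
qed

definition subsp :: "nat \<Rightarrow> 'a set set" where
  "subsp k = subspaces (frob_fixed (u ^ k))"

text \<open>The level of the subfield generated by the cubes of the subfield at level
  \<open>k\<close>: nonzero elements of a field with four elements have cube 1, so there the cubes
  generate only the prime field.\<close>

definition cube_level :: "nat \<Rightarrow> nat" where
  "cube_level k = (if u ^ k = 2 then 0 else k)"

text \<open>After the splitting, the second factor is closed under the cube of the generator.
  Outside the four-element case that cube is not in the preceding subfield, so the factor gains all
  scalars of level \<open>k\<close>.\<close>

lemma cube_modules_eq:
  assumes k: "1 \<le> k" "k \<le> b"
  shows "cube_modules (\<alpha> ^ qc_ind k) = (\<lambda>(V, V'). V \<times> V') ` (subsp k \<times> subsp (cube_level k))"
proof -
  interpret s: binary_subfield n \<alpha> "u ^ k" by (rule binary_subfield[OF k(2)])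
  have d: "2 \<le> u ^ k" by (rule pow_ge_2[OF k(1)])
  have "W \<in> (\<lambda>(V, V'). V \<times> V') ` (subsp k \<times> subsp (cube_level k))" if W: "W \<in> cube_modules s.gen" for W
  proof -
    note split = s.cube_module_eq_times[OF W d]
    let ?V = "{b. (0, b) \<in> W}"
    have "?V \<in> subsp (cube_level k)"
    proof (cases "u ^ k = 2")
      case True
      \<comment> \<open>The prime field has only the scalars 0 and 1, so an additive group is
        already a subspace over it.\<close>
      have "c = 0 \<or> c = 1" if "c \<in> frob_fixed 1" for c :: 'a
        using that by (simp add: frob_fixed_def power2_eq_square)
      then have "\<forall>c\<in>frob_fixed 1. \<forall>x\<in>?V. c * x \<in> ?V" using split(3) by fastforce
      then have "?V \<in> subspaces (frob_fixed 1)" using split(3,4) unfolding subspaces_def by blast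
      then show ?thesis using True by (simp add: subsp_def cube_level_def)
    next
      case False
      obtain l where l: "k = Suc l" using k by (cases k) auto
      have "?V \<in> subspaces (frob_fixed (u ^ Suc l))"
        using closed_under_next_subfield[OF prime_u n_eq _ split(3-5), of l] gen_cube_notin[of l] k False
        unfolding l by simp
      then show ?thesis using False by (simp add: subsp_def cube_level_def l)
    qed
    then show ?thesis using split(1,2) by (auto simp: subsp_def intro!: rev_image_eqI)
  qed
  moreover have "V \<times> V' \<in> cube_modules s.gen" if "V \<in> subsp k" "V' \<in> subsp (cube_level k)" for V V'
  proof -
    have "s.gen ^ 3 \<in> frob_fixed (u ^ cube_level k)"
    proof (cases "u ^ k = 2")
      case True
      then have "2 ^ u ^ k - 1 dvd (3 :: nat)" by simp
      then have "s.gen ^ 3 = 1" by (simp only: s.gen_power_eq_1)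
      then show ?thesis by (simp add: frob_fixed_def)
    next
      case False
      then show ?thesis
        using subfield_setD(5)[OF subfield_frob_fixed] s.gen_in
        by (simp add: cube_level_def power3_eq_cube)
    qed
    then show ?thesis
      using that times_in_cube_modules s.gen_in unfolding subsp_def by blast
  qed
  ultimately have "cube_modules s.gen = (\<lambda>(V, V'). V \<times> V') ` (subsp k \<times> subsp (cube_level k))"
    by auto
  then show ?thesis using gen_eq[OF k(2)] by simp
qed

lemma card_cube_modules:
  assumes k: "1 \<le> k" "k \<le> b"
  shows "card (cube_modules (\<alpha> ^ qc_ind k)) = card (subsp k) * card (subsp (cube_level k))"
  unfolding cube_modules_eq[OF k]
  by (rule card_times_image) (auto simp: subsp_def dest: subspacesD(1))

lemma card_subsp: "k \<le> b \<Longrightarrow> real (card (subsp k)) = 1 + num_subspaces (u ^ (b - k)) (2 ^ u ^ k)"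
  using binary_subfield.card_subspaces_frob_fixed[OF binary_subfield, of k] u_ge
  by (simp add: subsp_def n_eq power_diff)

lemma card_subsp_b: "card (subsp b) = 2"
proof -
  have "real (card (subsp b)) = 2"
    using card_subsp[of b] num_subspaces_1[of "2 ^ u ^ b"] u_ge
    by (simp del: One_nat_def add: one_less_power)
  then show ?thesis by simp
qed

lemma qc_ind_b: "qc_ind b = 1"
  using order_pos by (simp add: qc_ind_def flip: n_eq)

lemma b_pos: "1 \<le> b"
  using n_ge n_eq by (cases b) auto

lemma cube_level_b: "cube_level b = b"
  using n_ge n_eq by (simp add: cube_level_def)

text \<open>The kernel is invariant under a shift by one position, hence a product of two subspaces
  of the field over itself. Each is zero or everything, and the latter would make the trace vanish
  identically.\<close>

lemma inj_encode: "inj encode"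
proof -
  let ?W = "{p. encode p = 0\<^sub>v (2 ^ n - 1)}"
  have "encode (cube_act (\<alpha> ^ 1) p) = 0\<^sub>v (2 ^ n - 1)" if "encode p = 0\<^sub>v (2 ^ n - 1)" for p
    unfolding cyclic_shift_encode[symmetric] that by (intro eq_vecI) (simp_all add: cyclic_shift_def)
  then have "?W \<in> cube_modules (\<alpha> ^ qc_ind b)"
    by (simp add: cube_modules_def encode_0 encode_add qc_ind_b)
  then obtain V V' where VV: "?W = V \<times> V'" "V \<in> subsp b" "V' \<in> subsp b"
    using cube_modules_eq[OF b_pos] cube_level_b by auto
  have full: "U = {0}" if U: "U \<in> subsp b" and vanish: "\<And>x. x \<in> U \<Longrightarrow> trace n x = 0" for U
  proof (rule ccontr)
    assume "U \<noteq> {0}"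
    then obtain x where x: "x \<in> U" "x \<noteq> 0"
      using U subspacesD(1) unfolding subsp_def by blast
    have "y \<in> U" for y
      using subspacesD(3)[OF U[unfolded subsp_def], of "y / x" x] x frob_fixed_n by (simp add: n_eq)
    then show False using vanish trace_nontrivial by blast
  qed
  \<comment> \<open>The entry at position 0 of the codeword of \<open>(x, y)\<close> is the trace of
    \<open>x + y\<close>.\<close>
  have tr: "trace n (x + y) = 0" if "(x, y) \<in> ?W" for x y
  proof -
    have "encode (x, y) $ 0 = 0" using that order_pos by simp
    then show ?thesis using order_pos by (simp add: encode_def)
  qed
  have V0: "0 \<in> V" "0 \<in> V'" using VV subspacesD(1) unfolding subsp_def by blast+
  have "V = {0}" by (rule full[OF VV(2)]) (use tr[of _ 0] VV(1) V0 in auto)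
  moreover have "V' = {0}" by (rule full[OF VV(3)]) (use tr[of 0] VV(1) V0 in auto)
  ultimately have ker: "p = 0" if "encode p = 0\<^sub>v (2 ^ n - 1)" for p
    using VV(1) that by (auto simp: zero_prod_def)
  show ?thesis
  proof (rule injI)
    fix p q assume "encode p = encode q"
    moreover have "encode q + encode q = 0\<^sub>v (2 ^ n - 1)" by (intro eq_vecI) simp_all
    ultimately have "p + q = 0" by (intro ker) (simp add: encode_add)
    then have "fst p = fst q" "snd p = snd q"
      by (simp_all add: prod_eq_iff flip: diff_eq)
    then show "p = q" by (rule prod_eqI)
  qed
qed

text \<open>Each component is zero or the whole field, which leaves three nonzero products;
  minimality of the index 1 is vacuous.\<close>

lemma card_cyclic:
  "card (qc_subcodes (2 ^ n - 1) 1 (range encode)) = 3"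
  "range encode \<in> qc_subcodes (2 ^ n - 1) 1 (range encode)"
proof -
  have one: "0 < (1 :: nat)" by simp
  have "card (cube_modules (\<alpha> ^ 1)) = 4"
    using card_cube_modules[OF b_pos] by (simp add: qc_ind_b cube_level_b card_subsp_b)
  then show "card (qc_subcodes (2 ^ n - 1) 1 (range encode)) = 3"
    unfolding card_qc_subcodes[OF inj_encode one]
    using card_Diff_singleton[OF zero_in_cube_modules[of "\<alpha> ^ 1"]] by (simp add: set_diff_eq)
  have "(0, 1) \<in> (UNIV :: ('a \<times> 'a) set)" "(0, 1) \<noteq> (0 :: 'a \<times> 'a)" by (simp_all add: zero_prod_def)
  then have "UNIV \<noteq> {0 :: 'a \<times> 'a}" by blast
  then show "range encode \<in> qc_subcodes (2 ^ n - 1) 1 (range encode)"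
    unfolding qc_subcodes_encode[OF inj_encode one]
    by (intro imageI) (simp add: cube_modules_def)
qed

text \<open>The generator at level \<open>k\<close> lies in the next subfield and is therefore a
  power of the generator there.\<close>

lemma cube_modules_Suc_subset:
  assumes "k < b"
  shows "cube_modules (\<alpha> ^ qc_ind (Suc k)) \<subseteq> cube_modules (\<alpha> ^ qc_ind k)"
proof -
  interpret s: binary_subfield n \<alpha> "u ^ k" using assms by (intro binary_subfield) simp
  interpret t: binary_subfield n \<alpha> "u ^ Suc k" using assms by (intro binary_subfield) simp
  have "s.gen \<in> frob_fixed (u ^ Suc k)"
    using s.gen_in frob_fixed_mono[of "u ^ k" "u ^ Suc k"] by (auto simp: le_imp_power_dvd)
  then obtain i where "s.gen = t.gen ^ i" using t.obtain_gen_power s.gen_nz by metis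
  then have "cube_modules t.gen \<subseteq> cube_modules s.gen" using cube_modules_power by metis
  then show ?thesis using assms gen_eq[of k] gen_eq[of "Suc k"] by simp
qed

text \<open>A shift below the index number \<open>k\<close> multiplies by an element outside the subfield of
  degree \<open>u ^ k\<close>, hence extends the scalars of both components to the next subfield.\<close>

lemma exact_index_eq:
  assumes k: "1 \<le> k" "k < b"
  shows "{W \<in> cube_modules (\<alpha> ^ qc_ind k) - {{0}}.
      \<forall>m. 0 < m \<and> m < qc_ind k \<longrightarrow> W \<notin> cube_modules (\<alpha> ^ m)} =
    cube_modules (\<alpha> ^ qc_ind k) - cube_modules (\<alpha> ^ qc_ind (Suc k))"
proof -
  interpret s: binary_subfield n \<alpha> "u ^ k" using k by (intro binary_subfield) simp
  interpret t: binary_subfield n \<alpha> "u ^ Suc k" using k by (intro binary_subfield) simp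
  have "W \<in> cube_modules t.gen"
    if W: "W \<in> cube_modules s.gen" and m: "0 < m" "m < qc_ind k" "W \<in> cube_modules (\<alpha> ^ m)" for W m
  proof -
    note split = s.cube_module_eq_times[OF W pow_ge_2[OF k(1)]]
    let ?V = "{a. (a, 0) \<in> W}" and ?V' = "{b. (0, b) \<in> W}"
    have x: "\<alpha> ^ m \<notin> frob_fixed (u ^ k)"
      using m(1,2) k by (auto simp: s.alpha_power_in_frob_fixed qc_ind_eq dest: dvd_imp_le)
    \<comment> \<open>As 3 does not divide \<open>qc_ind k\<close>, cubing cannot bring
      \<open>\<alpha> ^ m\<close> into the subfield, so the second component gains scalars as
      well.\<close>
    have x3: "(\<alpha> ^ m) ^ 3 \<notin> frob_fixed (u ^ k)"
      using s.cube_in_frob_fixed[of "\<alpha> ^ m"] not_3_dvd_qc_ind[of k] x k by (auto simp: qc_ind_eq)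
    note sub = subspacesD[OF split(2)]
    have "\<alpha> ^ m * v \<in> ?V" if "v \<in> ?V" for v
      using cube_modulesD(3)[OF m(3), of "(v, 0)"] that by (simp add: cube_act_def)
    then have V: "?V \<in> subspaces (frob_fixed (u ^ Suc k))"
      using closed_under_next_subfield[OF prime_u n_eq k(2) sub(1,2) _ x] by blast
    have "(\<alpha> ^ m) ^ 3 * v \<in> ?V'" if "v \<in> ?V'" for v
      using cube_modulesD(3)[OF m(3), of "(0, v)"] that by (simp add: cube_act_def)
    then have V': "?V' \<in> subspaces (frob_fixed (u ^ Suc k))"
      using closed_under_next_subfield[OF prime_u n_eq k(2) split(3,4) _ x3] by blast
    have "t.gen ^ 3 \<in> frob_fixed (u ^ Suc k)"
      using subfield_setD(5)[OF subfield_frob_fixed] t.gen_in by (simp only: power3_eq_cube)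
    then show ?thesis
      using times_in_cube_modules[OF V V' t.gen_in] split(1) by simp
  qed
  then have "W \<in> cube_modules (\<alpha> ^ qc_ind (Suc k))"
    if "W \<in> cube_modules (\<alpha> ^ qc_ind k)" "0 < m" "m < qc_ind k" "W \<in> cube_modules (\<alpha> ^ m)" for W m
    using that k gen_eq[of k] gen_eq[of "Suc k"] by simp
  \<comment> \<open>Conversely, \<open>qc_ind (Suc k)\<close> is itself one of the smaller shifts.
    The zero module is invariant under it and thus disappears with the modules of the next
    level.\<close>
  moreover have "0 < qc_ind (Suc k)" "qc_ind (Suc k) < qc_ind k"
    using k by (auto intro: qc_ind_pos qc_ind_less)
  ultimately show ?thesis using zero_in_cube_modules by blast
qed

lemma card_qc_subcodes_qc_ind:
  assumes k: "1 \<le> k" "k < b"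
  shows "real (card (qc_subcodes (2 ^ n - 1) (qc_ind k) (range encode))) =
    real (card (subsp k)) * real (card (subsp (cube_level k))) - (real (card (subsp (Suc k))))\<^sup>2"
proof -
  \<comment> \<open>The four-element exception can occur only at level 1, so level
    \<open>Suc k\<close> contributes a square.\<close>
  have "u < u ^ Suc k" using power_strict_increasing[of 1 "Suc k" u] u_ge k by simp
  then have "u ^ Suc k \<noteq> 2" using u_ge by linarith
  then have "cube_level (Suc k) = Suc k" by (simp only: cube_level_def if_False)
  then have c: "card (cube_modules (\<alpha> ^ qc_ind (Suc k))) = card (subsp (Suc k)) * card (subsp (Suc k))"
    using card_cube_modules[of "Suc k"] k by simp
  have "0 < qc_ind k" using k by (intro qc_ind_pos) simp
  then have "card (qc_subcodes (2 ^ n - 1) (qc_ind k) (range encode)) =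
      card (cube_modules (\<alpha> ^ qc_ind k) - cube_modules (\<alpha> ^ qc_ind (Suc k)))"
    using card_qc_subcodes[OF inj_encode] exact_index_eq[OF k] by simp
  also have "\<dots> = card (cube_modules (\<alpha> ^ qc_ind k)) - card (cube_modules (\<alpha> ^ qc_ind (Suc k)))"
    using cube_modules_Suc_subset[OF k(2)] by (intro card_Diff_subset) auto
  finally have "real (card (qc_subcodes (2 ^ n - 1) (qc_ind k) (range encode))) =
      real (card (cube_modules (\<alpha> ^ qc_ind k))) - real (card (cube_modules (\<alpha> ^ qc_ind (Suc k))))"
    using card_mono[OF _ cube_modules_Suc_subset[OF k(2)]] by (simp add: of_nat_diff)
  then show ?thesis using card_cube_modules[of k] k by (simp add: c power2_eq_square)
qed

end

section \<open>Expressing the counts through the numbers \<open>A\<^sub>j\<close>\<close>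

theorem theorem5p2:
  fixes u a n N :: nat and \<alpha> :: "'f::finite_field" and C :: "bit vec set"
    and L :: "nat \<Rightarrow> nat" and A :: "nat \<Rightarrow> real"
  assumes "prime u" and "a \<ge> 2" and "(u, a) \<noteq> (2, 2)"
    and "n = u ^ (a - 1)" and "N = 2 ^ n - 1"
    and "CARD('f) = 2 ^ n" and "primitive_element \<alpha>"
    and "C = dual_bch n \<alpha>"
    and "L = qc_index u a" and "A = A_coeff u a"
  shows
    "(odd u \<longrightarrow>
        C \<in> cyclic_subcodes N C \<and> card (cyclic_subcodes N C) = 3 \<and>
        (a \<ge> 3 \<longrightarrow> card (qc_subcodes N (L (a - 1)) C) =
           3 * A (a - 2) + A (a - 2) * num_subspaces u (2 ^ (u ^ (a - 2)))) \<and>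
        (\<forall>j. 2 \<le> j \<and> j \<le> a - 2 \<longrightarrow> card (qc_subcodes N (L j) C) =
           2 * A (j - 1) + A (j - 1) *
             (num_subspaces (u ^ (a - j)) (2 ^ (u ^ (j - 1))) +
              num_subspaces (u ^ (a - j - 1)) (2 ^ (u ^ j))))) \<and>
     (u = 2 \<longrightarrow>
        C \<in> cyclic_subcodes N C \<and> card (cyclic_subcodes N C) = 3 \<and>
        (a \<ge> 4 \<longrightarrow>
           card (qc_subcodes N (L (a - 1)) C) =
             3 * A (a - 2) + A (a - 2) * num_subspaces u (2 ^ (u ^ (a - 2))) \<and>
           (\<forall>j. 3 \<le> j \<and> j \<le> a - 2 \<longrightarrow> card (qc_subcodes N (L j) C) =
              2 * A (j - 1) + A (j - 1) *
                (num_subspaces (u ^ (a - j)) (2 ^ (u ^ (j - 1))) +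
                 num_subspaces (u ^ (a - j - 1)) (2 ^ (u ^ j)))) \<and>
           card (qc_subcodes N (L 2) C) =
             2 * A 1 + A 0 + A 1 * num_subspaces (u ^ (a - 1)) 2 +
             (A 0 + A 1) * num_subspaces (u ^ (a - 3)) (2 ^ (u ^ 2))) \<and>
        (a = 3 \<longrightarrow> card (qc_subcodes N (L 2) C) =
           3 * A 1 + 2 * A 0 + A 1 * num_subspaces (u ^ 2) 2))"
proof -
  obtain b where a: "a = Suc b" and b: "1 \<le> b" using \<open>a \<ge> 2\<close> by (cases a) auto
  have n: "n = u ^ b" using assms(4) a by simp
  have u2: "2 \<le> u" using \<open>prime u\<close> by (rule prime_ge_2_nat)
  have "3 \<le> n"
  proof (cases "u = 2")
    case True
    then have "2 \<le> b" using assms(3) a b by auto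
    then show ?thesis using True n power_increasing[of 2 b "2 :: nat"] by simp
  next
    case False
    then show ?thesis using u2 n b power_increasing[of 1 b u] by simp
  qed
  then interpret prime_power_bch n \<alpha> u b
    using assms(1,6,7) n by unfold_locales
  have C: "C = range encode" using assms(8) by (simp add: dual_bch_eq_range)
  \<comment> \<open>\<open>S k\<close> includes the zero subspace, so it exceeds the corresponding
    \<open>num_subspaces\<close> by one.\<close>
  define S where "S k = real (card (subsp k))" for k
  have S: "num_subspaces (u ^ (b - k)) (2 ^ u ^ k) = S k - 1" if "k \<le> b" for k
    using card_subsp[OF that] by (simp add: S_def)
  have Sb: "S b = 2" by (simp add: S_def card_subsp_b)
  have A: "A k = S k - S (Suc k)" if "k < b" for k
    using that S[of k] S[of "Suc k"] by (simp add: assms(10) A_coeff_def a)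
  have L: "L (Suc k) = qc_ind k" for k
    unfolding qc_ind_def using assms(4) by (simp add: assms(9) qc_index_def)
  have count: "real (card (qc_subcodes N (L (Suc k)) C)) = S k * S (cube_level k) - S (Suc k) ^ 2"
    if "1 \<le> k" "k < b" for k
    using card_qc_subcodes_qc_ind[OF that] by (simp only: S_def L C assms(5))
  \<comment> \<open>Away from the four-element field the count is a difference of two squares, which
    factors as \<open>A k * (S k + S (Suc k))\<close>.\<close>
  have generic: "real (card (qc_subcodes N (L j) C)) = 2 * A (j - 1) + A (j - 1) *
      (num_subspaces (u ^ (a - j)) (2 ^ (u ^ (j - 1))) + num_subspaces (u ^ (a - j - 1)) (2 ^ (u ^ j)))"
    if j: "2 \<le> j" "j \<le> b" "u ^ (j - 1) \<noteq> 2" for j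
  proof -
    obtain k where k: "j = Suc k" "1 \<le> k" "k < b" using j by (cases j) auto
    then have "cube_level k = k" using j by (simp add: cube_level_def)
    then have "real (card (qc_subcodes N (L j) C)) = S k * S k - S (Suc k) ^ 2"
      using count[of k] k by simp
    also have "\<dots> = 2 * A k + A k * ((S k - 1) + (S (Suc k) - 1))"
      unfolding A[OF k(3)] by (simp add: power2_eq_square algebra_simps)
    finally have "real (card (qc_subcodes N (L j) C)) = 2 * A k + A k * ((S k - 1) + (S (Suc k) - 1))" .
    moreover have "j - 1 = k" "a - j = b - k" "a - j - 1 = b - Suc k" using k a by simp_all
    moreover have "num_subspaces (u ^ (b - k)) (2 ^ u ^ k) = S k - 1"
      "num_subspaces (u ^ (b - Suc k)) (2 ^ u ^ Suc k) = S (Suc k) - 1"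
      using k by (simp_all only: S less_imp_le Suc_le_eq)
    ultimately show ?thesis by (simp only: k(1))
  qed
  \<comment> \<open>The top case of \<open>generic\<close>: since \<open>S b = 2\<close>, the second
    subspace number is 1, which accounts for the coefficient 3.\<close>
  have last: "real (card (qc_subcodes N (L (a - 1)) C)) =
      3 * A (a - 2) + A (a - 2) * num_subspaces u (2 ^ (u ^ (a - 2)))"
    if "2 \<le> b" "u ^ (b - 1) \<noteq> 2"
    using generic[of b] S[of b] Sb that by (simp add: a algebra_simps)
  have cyc: "C \<in> cyclic_subcodes N C \<and> card (cyclic_subcodes N C) = 3"
    using card_cyclic by (simp only: cyclic_subcodes_def C assms(5) simp_thms)
  have big: "u ^ k \<noteq> 2" if "1 \<le> k" "u \<noteq> 2 \<or> 2 \<le> k" for k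
  proof
    assume eq: "u ^ k = 2"
    have "u \<le> u ^ k" using that(1) u2 power_increasing[of 1 k u] by simp
    then have "u = 2" using eq u2 by simp
    then show False using eq that power_inject_exp[of "2 :: nat" k 1] by simp
  qed
  \<comment> \<open>For \<open>u = 2\<close>, level 1 is the field with four elements, so the second
    factor ranges over the subspaces over the prime field, counted by \<open>S 0\<close>.\<close>
  have two: "real (card (qc_subcodes N (L 2) C)) = S 1 * S 0 - S 2 ^ 2" if "u = 2" "2 \<le> b"
  proof -
    have "cube_level 1 = 0" unfolding cube_level_def using that by simp
    then show ?thesis using count[of 1] that(2) by (simp add: numeral_2_eq_2)
  qed
  have A01: "A 0 = S 0 - S 1" "A 1 = S 1 - S 2" if "2 \<le> b"
    using A[of 0] A[of 1] that by (simp_all add: numeral_2_eq_2)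
  have S0: "num_subspaces (u ^ b) 2 = S 0 - 1" using S[of 0] by simp
  have case2: "real (card (qc_subcodes N (L 2) C)) =
      2 * A 1 + A 0 + A 1 * num_subspaces (u ^ (a - 1)) 2 +
      (A 0 + A 1) * num_subspaces (u ^ (a - 3)) (2 ^ (u ^ 2))" if "u = 2" "2 \<le> b"
  \<comment> \<open>The formula comes from
    \<open>S 1 * S 0 - S 2 ^ 2 = A 1 * S 0 + (A 0 + A 1) * S 2\<close>, where
    \<open>A 0 + A 1\<close> telescopes to \<open>S 0 - S 2\<close>.\<close>
  proof -
    have "a - 3 = b - 2" "a - 1 = b" by (simp_all add: a)
    then have num: "num_subspaces (u ^ (a - 3)) (2 ^ (u ^ 2)) = S 2 - 1"
      "num_subspaces (u ^ (a - 1)) 2 = S 0 - 1"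
      using S[OF that(2)] S0 by (simp_all only:)
    show ?thesis
      unfolding num two[OF that] A01[OF that(2)] by (simp add: power2_eq_square algebra_simps)
  qed
  have case3: "real (card (qc_subcodes N (L 2) C)) =
      3 * A 1 + 2 * A 0 + A 1 * num_subspaces (u ^ 2) 2" if "u = 2" "a = 3"
  proof -
    have b2: "b = 2" "2 \<le> b" using that a by simp_all
    then have num: "num_subspaces (u ^ 2) 2 = S 0 - 1" "S 2 = 2" using S0 Sb by simp_all
    show ?thesis unfolding num two[OF that(1) b2(2)] A01[OF b2(2)] by (simp add: algebra_simps)
  qed
  have u_neq: "u \<noteq> 2" if "odd u" using that by auto
  show ?thesis
  proof (intro conjI impI allI)
    assume "odd u" "3 \<le> a"
    then show "real (card (qc_subcodes N (L (a - 1)) C)) =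
        3 * A (a - 2) + A (a - 2) * num_subspaces u (2 ^ (u ^ (a - 2)))"
      using u_neq by (intro last big) (auto simp: a)
  next
    fix j assume "odd u" "2 \<le> j \<and> j \<le> a - 2"
    then show "real (card (qc_subcodes N (L j) C)) = 2 * A (j - 1) + A (j - 1) *
        (num_subspaces (u ^ (a - j)) (2 ^ (u ^ (j - 1))) + num_subspaces (u ^ (a - j - 1)) (2 ^ (u ^ j)))"
      using u_neq by (intro generic big) (auto simp: a)
  next
    assume "u = 2" "4 \<le> a"
    then show "real (card (qc_subcodes N (L (a - 1)) C)) =
        3 * A (a - 2) + A (a - 2) * num_subspaces u (2 ^ (u ^ (a - 2)))"
      by (intro last big) (auto simp: a)
  next
    fix j assume "u = 2" "4 \<le> a" "3 \<le> j \<and> j \<le> a - 2"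
    then show "real (card (qc_subcodes N (L j) C)) = 2 * A (j - 1) + A (j - 1) *
        (num_subspaces (u ^ (a - j)) (2 ^ (u ^ (j - 1))) + num_subspaces (u ^ (a - j - 1)) (2 ^ (u ^ j)))"
      by (intro generic big) (auto simp: a)
  next
    assume "u = 2" "4 \<le> a"
    then show "real (card (qc_subcodes N (L 2) C)) =
        2 * A 1 + A 0 + A 1 * num_subspaces (u ^ (a - 1)) 2 +
        (A 0 + A 1) * num_subspaces (u ^ (a - 3)) (2 ^ (u ^ 2))"
      by (intro case2) (auto simp: a)
  qed (use cyc case3 in blast)+
qed

end
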